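(* Let $n\ge 1$, let $m > m_1 > \dots > m_n > 0$ be integers, let $d=\gcd(m,m_1,\dots,m_n)$ and $\varepsilon = e^{2\pi i/m}$. If $d>1$, then the family $$\{\,y_{pr}(\varepsilon^{i_1}x_1,\dots,\varepsilon^{i_n}x_n)\,\}_{(i_1,\dots,i_n)\in B}$$ is a basis in the solution space (near the origin) of the Mellin system associated with $(m;m_1,\dots,m_n)$, where $y_{pr}$ is the principal solution. In particular, if $d>1$, all solutions to the Mellin system are algebraic functions.
   Context: Put $m_j' = m-m_j$ and $\theta_j = x_j\,\partial/\partial x_j$. The Mellin system associated with $(m;m_1,\dots,m_n)$ is the following system of $n$ linear partial differential equations for $y(x)=y(x_1,\dots,x_n)$: $$\prod_{k=0}^{m_j-1}(m_1\theta_1+\dots+m_n\theta_n+mk+1)\prod_{k=0}^{m_j'-1}(m_1'\theta_1+\dots+m_n'\theta_n+mk-1)\,y(x) = (-1)^{m_j}m^m\frac{\partial^m y(x)}{\partial x_j^m},\quad j=1,\dots,n.$$ The set $B$ is $B=\{(i_1,\dots,i_n)\in\mathbb{Z}^n : 0\le i_j\le m-1 \text{ for } j=1,\dots,n\}$. The principal solution $y_{pr}$ is the analytic solution near the origin of the algebraic equation $y^m + x_1y^{m_1}+\dots+x_ny^{m_n}-1=0$ with $y_{pr}(0)=1$. By a classical result of Mellin it solves the Mellin system and its power series expansion is $$y_{pr}(x)=\sum_{\nu_1,\dots,\nu_n\ge 0}\frac{(-1)^{|\nu|}}{m^{|\nu|}}\,\frac{\prod_{\mu=1}^{|\nu|-1}(m_1\nu_1+\dots+m_n\nu_n-m\mu+1)}{\nu_1!\cdots\nu_n!}\,x_1^{\nu_1}\cdots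 x_n^{\nu_n},$$ where $|\nu|=\nu_1+\dots+\nu_n$ and the empty product is defined to be $1$ (for $\nu=0$ the coefficient is $1$). *)

theory Defs
  imports "HOL-Analysis.Analysis"
begin

section \<open>Analytic functions of several complex variables\<close>

text \<open>
  The \<open>n\<close> variables are indexed by a finite linearly ordered type \<^typ>\<open>'n\<close>, so that
  \<open>\<complex>\<^sup>n\<close> is \<open>complex ^ 'n\<close>; multi-indices are functions into \<^typ>\<open>nat\<close> or \<^typ>\<open>int\<close>.
\<close>

definition monomial :: "('n \<Rightarrow> nat) \<Rightarrow> complex ^ 'n::finite \<Rightarrow> complex" where
  "monomial \<nu> x = (\<Prod>j\<in>UNIV. (x $ j) ^ \<nu> j)"

definition mv_analytic_on :: "(complex ^ 'n::finite \<Rightarrow> complex) \<Rightarrow> (complex ^ 'n) set \<Rightarrow> bool" where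
  "mv_analytic_on f U \<longleftrightarrow>
     (\<forall>a\<in>U. \<exists>r>0. \<exists>c. \<forall>x\<in>ball a r. ((\<lambda>\<nu>. c \<nu> * monomial \<nu> (x - a)) has_sum f x) UNIV)"

definition polynomial_map :: "(complex ^ 'n::finite \<Rightarrow> complex) \<Rightarrow> bool" where
  "polynomial_map p \<longleftrightarrow> (\<exists>S c. finite S \<and> p = (\<lambda>x. \<Sum>\<nu>\<in>S. c \<nu> * monomial \<nu> x))"

text \<open>
  Algebraicity over \<open>\<complex>(x\<^sub>1,\<dots>,x\<^sub>n)\<close>, with denominators cleared. As \<open>\<complex>\<close> is infinite, a
  polynomial is non-zero iff the function it defines is not identically zero.
\<close>

definition algebraic_function_on ::
  "(complex ^ 'n::finite) set \<Rightarrow> (complex ^ 'n \<Rightarrow> complex) \<Rightarrow> bool" where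
  "algebraic_function_on U f \<longleftrightarrow>
     (\<exists>N>0. \<exists>a. (\<forall>k\<le>N. polynomial_map (a k)) \<and> a N \<noteq> (\<lambda>x. 0) \<and>
        (\<forall>x\<in>U. (\<Sum>k\<le>N. a k x * f x ^ k) = 0))"

definition partial_deriv ::
  "'n \<Rightarrow> (complex ^ 'n::finite \<Rightarrow> complex) \<Rightarrow> complex ^ 'n \<Rightarrow> complex" where
  "partial_deriv j f x = deriv (\<lambda>t. f (x + axis j t)) 0"

definition theta ::
  "'n \<Rightarrow> (complex ^ 'n::finite \<Rightarrow> complex) \<Rightarrow> complex ^ 'n \<Rightarrow> complex" where
  "theta j f x = x $ j * partial_deriv j f x"


section \<open>Germs at the origin\<close>

definition germ_eq ::
  "(complex ^ 'n::finite \<Rightarrow> complex) \<Rightarrow> (complex ^ 'n \<Rightarrow> complex) \<Rightarrow> bool" where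
  "germ_eq f g \<longleftrightarrow> (\<forall>\<^sub>F x in nhds 0. f x = g x)"

lemma equivp_germ_eq: "equivp germ_eq"
proof (rule equivpI)
  show "reflp germ_eq" by (simp add: reflp_def germ_eq_def)
  show "symp germ_eq" by (simp add: symp_def germ_eq_def eq_commute)
  show "transp germ_eq"
    unfolding transp_def germ_eq_def by (auto elim: eventually_elim2)
qed

quotient_type (overloaded) 'n germ = "complex ^ 'n::finite \<Rightarrow> complex" / germ_eq
  morphisms rep_germ germ_of
  by (rule equivp_germ_eq)

instantiation germ :: (finite) ab_group_add
begin

lift_definition zero_germ :: "'a germ" is "\<lambda>x. 0" .

lift_definition plus_germ :: "'a germ \<Rightarrow> 'a germ \<Rightarrow> 'a germ" is "\<lambda>f g x. f x + g x"
  unfolding germ_eq_def by (auto elim: eventually_elim2)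

lift_definition minus_germ :: "'a germ \<Rightarrow> 'a germ \<Rightarrow> 'a germ" is "\<lambda>f g x. f x - g x"
  unfolding germ_eq_def by (auto elim: eventually_elim2)

lift_definition uminus_germ :: "'a germ \<Rightarrow> 'a germ" is "\<lambda>f x. - f x"
  unfolding germ_eq_def by (auto elim: eventually_mono)

instance
  by standard (transfer; simp add: germ_eq_def algebra_simps)+

end

lift_definition scale_germ :: "complex \<Rightarrow> 'n::finite germ \<Rightarrow> 'n germ" is "\<lambda>c f x. c * f x"
  unfolding germ_eq_def by (auto elim: eventually_mono)

interpretation germ: vector_space scale_germ
  by standard (transfer; simp add: germ_eq_def algebra_simps)+


section \<open>The Mellin system\<close>

definition euler_op ::
  "('n \<Rightarrow> nat) \<Rightarrow> complex \<Rightarrow> (complex ^ 'n::finite \<Rightarrow> complex) \<Rightarrow> complex ^ 'n \<Rightarrow> complex" where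
  "euler_op a c f x = (\<Sum>j\<in>UNIV. of_nat (a j) * theta j f x) + c * f x"

text \<open>
  The products of differential operators are compositions; the factors commute on analytic
  functions, so the order of composition is immaterial.
\<close>

definition mellin_lhs ::
  "nat \<Rightarrow> ('n \<Rightarrow> nat) \<Rightarrow> 'n \<Rightarrow> (complex ^ 'n::finite \<Rightarrow> complex) \<Rightarrow> complex ^ 'n \<Rightarrow> complex" where
  "mellin_lhs m \<mu> j f =
     foldr (\<lambda>k. euler_op \<mu> (of_nat (m * k) + 1)) [0..<\<mu> j]
       (foldr (\<lambda>k. euler_op (\<lambda>i. m - \<mu> i) (of_nat (m * k) - 1)) [0..<m - \<mu> j] f)"

definition mellin_solution_on ::
  "nat \<Rightarrow> ('n \<Rightarrow> nat) \<Rightarrow> (complex ^ 'n::finite) set \<Rightarrow> (complex ^ 'n \<Rightarrow> complex) \<Rightarrow> bool" where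
  "mellin_solution_on m \<mu> U f \<longleftrightarrow> mv_analytic_on f U \<and>
     (\<forall>x\<in>U. \<forall>j. mellin_lhs m \<mu> j f x =
        (-1) ^ \<mu> j * of_nat m ^ m * (partial_deriv j ^^ m) f x)"

definition mellin_solution_space :: "nat \<Rightarrow> ('n \<Rightarrow> nat) \<Rightarrow> 'n::finite germ set" where
  "mellin_solution_space m \<mu> =
     {germ_of f | f. \<exists>U. open U \<and> 0 \<in> U \<and> mellin_solution_on m \<mu> U f}"

definition is_principal_solution ::
  "nat \<Rightarrow> ('n \<Rightarrow> nat) \<Rightarrow> (complex ^ 'n::finite \<Rightarrow> complex) \<Rightarrow> bool" where
  "is_principal_solution m \<mu> y \<longleftrightarrow> y 0 = 1 \<and>
     (\<exists>U. open U \<and> 0 \<in> U \<and> mv_analytic_on y U \<and>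
        (\<forall>x\<in>U. y x ^ m + (\<Sum>j\<in>UNIV. x $ j * y x ^ \<mu> j) - 1 = 0))"

text \<open>
  For \<open>m > 0\<close> the principal solution exists, by the implicit function theorem, and its germ at
  the origin is unique; the choice below only selects a representative of that germ.
\<close>

definition y_pr :: "nat \<Rightarrow> ('n \<Rightarrow> nat) \<Rightarrow> complex ^ 'n::finite \<Rightarrow> complex" where
  "y_pr m \<mu> = (SOME y. is_principal_solution m \<mu> y)"

definition mellin_eps :: "nat \<Rightarrow> complex" where
  "mellin_eps m = exp (2 * of_real pi * \<i> / of_nat m)"

definition mellin_B :: "nat \<Rightarrow> ('n \<Rightarrow> int) set" where
  "mellin_B m = {i. \<forall>j. 0 \<le> i j \<and> i j \<le> int m - 1}"

definition y_pr_rotated :: "nat \<Rightarrow> ('n \<Rightarrow> nat) \<Rightarrow> ('n \<Rightarrow> int) \<Rightarrow> complex ^ 'n::finite \<Rightarrow> complex" where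
  "y_pr_rotated m \<mu> i x = y_pr m \<mu> (\<chi> j. mellin_eps m powi i j * x $ j)"

end

theory Submission
  imports Defs "HOL-Complex_Analysis.Conformal_Mappings" "Jordan_Normal_Form.Char_Poly"
begin

text \<open>
  On power series the Mellin system is a recurrence. Since \<open>\<theta>\<^sub>j\<close> acts diagonally on monomials, the
  \<open>j\<close>-th equation says \<open>A\<^sub>j(\<nu>) c\<^sub>\<nu> = L\<^sub>j(\<nu>) c\<^sub>\<nu>\<^sub>'\<close> for the coefficients of a solution, where \<open>\<nu>'\<close> is \<open>\<nu>\<close> with
  \<open>m\<close> added to its \<open>j\<close>-th entry and \<open>L\<^sub>j(\<nu>) \<noteq> 0\<close>. The coefficients \<open>p\<^sub>\<nu>\<close> of the principal solution
  satisfy the same recurrence (\<open>mellin_recurrence_root_coeff\<close>). They are given by a product of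
  integers, all congruent to \<open>1\<close> modulo \<open>d = gcd(m, m\<^sub>1, \<dots>, m\<^sub>n)\<close>, so for \<open>d > 1\<close> none of them vanishes
  (\<open>root_coeff_1_nonzero\<close>). Hence for every solution the quotient \<open>c\<^sub>\<nu> / p\<^sub>\<nu>\<close> depends only on \<open>\<nu>\<close>
  modulo \<open>m\<close>. The functions on \<open>(\<int>/m)\<^sup>n\<close> have the characters \<open>\<nu> \<mapsto> \<epsilon>\<^bsup>i \<bullet> \<nu>\<^esup>\<close>, \<open>i \<in> B\<close>, as a basis, and
  multiplying \<open>p\<^sub>\<nu>\<close> by such a character is the effect of the rotation
  \<open>x\<^sub>j \<mapsto> \<epsilon>\<^bsup>i\<^sub>j\<^esup> x\<^sub>j\<close> on the principal solution. This gives independence and spanning at once, the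
  span being formed by convergent series because the principal solution converges.

  The expansion of the principal solution rests on an addition law. Let \<open>a\<^sub>\<nu>(s)\<close> be the coefficients
  that Lagrange inversion predicts for the \<open>s\<close>-th power of the root (\<open>root_coeff\<close>). An elementary
  computation gives the coefficient form of \<open>Y\<^bsup>s+m\<^esup> - Y\<^bsup>s\<^esup> = - \<Sum>\<^sub>j x\<^sub>j Y\<^bsup>s+m\<^sub>j\<^esup>\<close>
  (\<open>root_coeff_difference\<close>). By induction on the degree it follows that the defect of
  \<open>a(s) * a(t) = a(s + t)\<close> is a polynomial in \<open>s\<close> with period \<open>m\<close>, hence constant, and it is \<open>0\<close> at
  \<open>s = 0\<close> (\<open>root_coeff_mconv\<close>). So the series with coefficients \<open>a(s)\<close> is the \<open>s\<close>-th power of the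
  series with coefficients \<open>a(1)\<close>, and the difference equation at \<open>s = 0\<close> becomes the algebraic
  equation. The root near \<open>1\<close> being unique, this series is the principal solution.

  For algebraicity, the rotated principal solutions are integral over the ring of polynomials, and
  integrality survives linear combinations: if \<open>g\<close> multiplies a finitely generated module containing
  \<open>1\<close> into itself, then \<open>g(x)\<close> is an eigenvalue of a matrix with polynomial entries, and the
  characteristic polynomial is a monic equation for \<open>g\<close>. Near the origin every solution satisfies
  such an equation, and the identity theorem extends it to the whole domain.
\<close>

text \<open>Below, \<open>x $ j\<close> always denotes a coordinate of a point of \<open>\<complex>\<^sup>n\<close>.\<close>

no_notation Matrix.vec_index (infixl "$" 100)


section \<open>Power series on polydiscs\<close>

text \<open>
  Polydiscs are preferred to balls because they contain diagonal points \<open>(\<sigma>, \<dots>, \<sigma>)\<close>, at which a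
  power series dominates its values on the whole smaller polydisc, and because rotations of the
  coordinates preserve them.
\<close>

definition polydisc :: "real \<Rightarrow> (complex ^ 'n::finite) set" where
  "polydisc \<rho> = {x. \<forall>j. norm (x $ j) < \<rho>}"

definition has_pseries ::
  "(('n::finite \<Rightarrow> nat) \<Rightarrow> complex) \<Rightarrow> (complex ^ 'n \<Rightarrow> complex) \<Rightarrow> real \<Rightarrow> bool" where
  "has_pseries c f \<rho> \<longleftrightarrow> (\<forall>x\<in>polydisc \<rho>. ((\<lambda>\<nu>. c \<nu> * monomial \<nu> x) has_sum f x) UNIV)"

lemma polydisc_eq_INT: "polydisc \<rho> = (\<Inter>j. {x. norm (x $ j) < \<rho>})"
  by (auto simp: polydisc_def)

lemma open_polydisc: "open (polydisc \<rho>)"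
  unfolding polydisc_eq_INT
  by (intro open_INT ballI open_Collect_less continuous_intros) auto

lemma zero_in_polydisc: "0 < \<rho> \<Longrightarrow> 0 \<in> polydisc \<rho>"
  by (simp add: polydisc_def)

lemma polydisc_mono: "\<rho> \<le> \<rho>' \<Longrightarrow> polydisc \<rho> \<subseteq> polydisc \<rho>'"
  by (auto simp: polydisc_def intro: less_le_trans)

lemma polydisc_in_open:
  fixes U :: "(complex ^ 'n::finite) set"
  assumes "open U" "0 \<in> U"
  obtains \<rho> where "0 < \<rho>" "polydisc \<rho> \<subseteq> U"
proof -
  obtain r where r: "r > 0" "ball 0 r \<subseteq> U"
    using assms openE by blast
  define \<rho> where "\<rho> = r / real CARD('n)"
  have "norm x < r" if "x \<in> polydisc \<rho>" for x :: "complex ^ 'n"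
  proof -
    have "norm x \<le> (\<Sum>j\<in>UNIV. norm (x $ j))"
      unfolding norm_vec_def by (rule L2_set_le_sum) simp
    also have "\<dots> < (\<Sum>j\<in>(UNIV::'n set). \<rho>)"
      using that by (intro sum_strict_mono) (auto simp: polydisc_def)
    also have "\<dots> = r" by (simp add: \<rho>_def)
    finally show ?thesis .
  qed
  then have "polydisc \<rho> \<subseteq> U" using r by auto
  moreover have "\<rho> > 0" using r by (simp add: \<rho>_def)
  ultimately show ?thesis using that by blast
qed

lemma has_pseries_mono: "has_pseries c f \<rho> \<Longrightarrow> \<rho>' \<le> \<rho> \<Longrightarrow> has_pseries c f \<rho>'"
  using polydisc_mono unfolding has_pseries_def by blast

text \<open>
  A finite maximum leaves room below \<open>\<rho>\<close>; this room is what termwise differentiation and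
  re-expansion use up.
\<close>

lemma polydisc_radius:
  fixes x :: "complex ^ 'n::finite"
  assumes "x \<in> polydisc \<rho>"
  obtains \<sigma> where "0 < \<sigma>" "\<sigma> < \<rho>" "\<And>j. norm (x $ j) < \<sigma>"
proof -
  define M where "M = Max (range (\<lambda>j. norm (x $ j)))"
  have le: "norm (x $ j) \<le> M" for j unfolding M_def by (intro Max_ge) auto
  have "M \<in> range (\<lambda>j. norm (x $ j))" unfolding M_def by (intro Max_in) auto
  then have M: "M < \<rho>" "0 \<le> M" using assms by (auto simp: polydisc_def)
  show ?thesis
  proof (rule that[of "(M + \<rho>) / 2"])
    show "norm (x $ j) < (M + \<rho>) / 2" for j
      using le[of j] M by (auto simp: field_simps)
  qed (use M in auto)
qed

lemma norm_monomial_le: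
  assumes "\<And>j. norm (x $ j) \<le> \<sigma>"
  shows "norm (monomial \<nu> x) \<le> \<sigma> ^ (\<Sum>j\<in>UNIV. \<nu> j)"
  unfolding monomial_def prod_norm[symmetric] norm_power power_sum
  by (intro prod_mono conjI power_mono assms) auto

lemma monomial_scale: "monomial \<nu> (\<chi> j. w * v $ j) = w ^ (\<Sum>j\<in>UNIV. \<nu> j) * monomial \<nu> v"
  by (simp add: monomial_def power_mult_distrib prod.distrib power_sum)

lemma monomial_zero: "monomial \<nu> (0 :: complex ^ 'n::finite) = (if \<nu> = (\<lambda>_. 0) then 1 else 0)"
  by (auto simp: monomial_def fun_eq_iff prod_zero_iff power_0_left)

text \<open>
  Evaluation at the diagonal point \<open>(\<sigma>, \<dots>, \<sigma>)\<close>, where unconditional convergence of complex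
  families means absolute convergence. The result is the majorant for all M-tests on the polydisc of
  radius \<open>\<sigma>\<close>.
\<close>

lemma has_pseries_abs_summable:
  fixes c :: "('n::finite \<Rightarrow> nat) \<Rightarrow> complex"
  assumes "has_pseries c f \<rho>" "0 \<le> \<sigma>" "\<sigma> < \<rho>"
  shows "(\<lambda>\<nu>. norm (c \<nu>) * \<sigma> ^ (\<Sum>j\<in>UNIV. \<nu> j)) summable_on UNIV"
proof -
  let ?x = "(\<chi> j. of_real \<sigma>) :: complex ^ 'n"
  have "?x \<in> polydisc \<rho>" using assms by (simp add: polydisc_def)
  then have "(\<lambda>\<nu>. c \<nu> * monomial \<nu> ?x) summable_on UNIV"
    using assms(1) has_sum_imp_summable unfolding has_pseries_def by blast
  then have "(\<lambda>\<nu>. norm (c \<nu> * monomial \<nu> ?x)) summable_on UNIV"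
    by (rule summable_on_iff_abs_summable_on_complex[THEN iffD1])
  moreover have "norm (c \<nu> * monomial \<nu> ?x) = norm (c \<nu>) * \<sigma> ^ (\<Sum>j\<in>UNIV. \<nu> j)" for \<nu>
    using assms(2) by (simp add: norm_mult monomial_def power_sum prod_norm[symmetric] norm_power)
  ultimately show ?thesis by simp
qed

lemma has_pseries_add:
  "has_pseries c f \<rho> \<Longrightarrow> has_pseries d g \<rho> \<Longrightarrow> has_pseries (\<lambda>\<nu>. c \<nu> + d \<nu>) (\<lambda>x. f x + g x) \<rho>"
  unfolding has_pseries_def by (auto simp: distrib_right intro!: has_sum_add)

lemma has_pseries_cmult:
  "has_pseries c f \<rho> \<Longrightarrow> has_pseries (\<lambda>\<nu>. a * c \<nu>) (\<lambda>x. a * f x) \<rho>"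
  unfolding has_pseries_def mult.assoc by (auto intro!: has_sum_cmult_right)

lemma has_pseries_0: "has_pseries (\<lambda>_. 0) (\<lambda>_. 0) \<rho>"
  by (simp add: has_pseries_def)

lemma has_pseries_sum:
  assumes "\<And>i. i \<in> I \<Longrightarrow> has_pseries (c i) (f i) \<rho>"
  shows "has_pseries (\<lambda>\<nu>. \<Sum>i\<in>I. c i \<nu>) (\<lambda>x. \<Sum>i\<in>I. f i x) \<rho>"
  using assms
proof (induction I rule: infinite_finite_induct)
  case (insert i I)
  then show ?case by (simp add: has_pseries_add)
qed (auto simp: has_pseries_0)

text \<open>Termwise differentiation along a line.\<close>

text \<open>
  Weierstrass: the majorant makes the partial sums converge uniformly, and locally uniform limits of
  holomorphic functions are differentiated termwise. Convergence of the differentiated family is part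
  of what the theorem delivers.
\<close>

lemma has_sum_termwise_derivative:
  fixes g :: "'i \<Rightarrow> complex \<Rightarrow> complex"
  assumes "0 < \<delta>"
    and sum: "\<And>t. norm t \<le> \<delta> \<Longrightarrow> ((\<lambda>i. g i t) has_sum F t) I"
    and bound: "\<And>i t. i \<in> I \<Longrightarrow> norm t \<le> \<delta> \<Longrightarrow> norm (g i t) \<le> M i"
    and M: "M summable_on I"
    and deriv: "\<And>i t. i \<in> I \<Longrightarrow> (g i has_field_derivative g' i t) (at t)"
  shows "F field_differentiable at 0" and "((\<lambda>i. g' i 0) has_sum deriv F 0) I"
proof -
  have ul: "uniform_limit (cball 0 \<delta>) (\<lambda>X t. \<Sum>i\<in>X. g i t) F (finite_subsets_at_top I)"
    by (rule Weierstrass_m_test_general'[OF _ _ M]) (use bound sum in auto)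
  have ev: "\<forall>\<^sub>F X in finite_subsets_at_top I. continuous_on (cball 0 \<delta>) (\<lambda>t. \<Sum>i\<in>X. g i t) \<and>
     (\<forall>w\<in>ball 0 \<delta>. ((\<lambda>t. \<Sum>i\<in>X. g i t) has_field_derivative (\<Sum>i\<in>X. g' i w)) (at w))"
  proof (rule eventually_finite_subsets_at_top_weakI, intro conjI ballI)
    fix X assume X: "finite X" "X \<subseteq> I"
    show d: "((\<lambda>t. \<Sum>i\<in>X. g i t) has_field_derivative (\<Sum>i\<in>X. g' i w)) (at w)" for w
      by (rule DERIV_sum) (use X deriv in auto)
    then show "continuous_on (cball 0 \<delta>) (\<lambda>t. \<Sum>i\<in>X. g i t)"
      by (meson DERIV_isCont continuous_at_imp_continuous_on)
  qed
  obtain F' where F': "\<And>w. w \<in> ball 0 \<delta> \<Longrightarrow> (F has_field_derivative (F' w)) (at w) \<and>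
      ((\<lambda>X. \<Sum>i\<in>X. g' i w) \<longlongrightarrow> F' w) (finite_subsets_at_top I)"
    using has_complex_derivative_uniform_limit[OF ev ul _ \<open>0 < \<delta>\<close>] by auto
  have 0: "(F has_field_derivative F' 0) (at 0)" "((\<lambda>i. g' i 0) has_sum F' 0) I"
    using F'[of 0] \<open>0 < \<delta>\<close> by (auto simp: has_sum_def)
  then show "F field_differentiable at 0" "((\<lambda>i. g' i 0) has_sum deriv F 0) I"
    using DERIV_imp_deriv[OF 0(1)] by (auto simp: field_differentiable_def)
qed

lemma monomial_split:
  "monomial \<nu> x = (x $ j) ^ \<nu> j * (\<Prod>i\<in>UNIV - {j}. (x $ i) ^ \<nu> i)"
  unfolding monomial_def by (subst prod.remove[of _ j]) auto

lemma monomial_Suc: "monomial (\<nu>(j := Suc (\<nu> j))) x = x $ j * monomial \<nu> x"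
  by (simp add: monomial_split[of _ _ j])

lemma has_field_derivative_monomial_axis:
  "((\<lambda>t. monomial \<nu> (x + axis j t)) has_field_derivative
      of_nat (\<nu> j) * monomial (\<nu>(j := \<nu> j - 1)) (x + axis j t)) (at t)"
proof -
  have eq: "monomial \<kappa> (x + axis j s) = (x $ j + s) ^ \<kappa> j * (\<Prod>i\<in>UNIV - {j}. (x $ i) ^ \<kappa> i)" for \<kappa> s
    unfolding monomial_split[of _ _ j] by (auto simp: axis_def intro!: prod.cong)
  show ?thesis
    unfolding eq by (auto intro!: derivative_eq_intros)
qed

lemma axis_zero: "axis j 0 = 0"
  by (simp add: axis_def Finite_Cartesian_Product.vec_eq_iff)

text \<open>
  The terms with \<open>\<nu> j > 0\<close> are exactly the shifts, so differentiation in \<open>x\<^sub>j\<close> and multiplication by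
  \<open>x\<^sub>j\<close> become index shifts of the coefficients.
\<close>

lemma has_sum_shift:
  fixes g :: "('n \<Rightarrow> nat) \<Rightarrow> complex"
  assumes "\<And>\<nu>. \<nu> j = 0 \<Longrightarrow> g \<nu> = 0"
  shows "(g has_sum s) UNIV \<longleftrightarrow> ((\<lambda>\<nu>. g (\<nu>(j := Suc (\<nu> j)))) has_sum s) UNIV"
proof -
  have "(g has_sum s) UNIV \<longleftrightarrow> (g has_sum s) (range (\<lambda>\<nu>. \<nu>(j := Suc (\<nu> j))))"
  proof (rule has_sum_cong_neutral)
    fix \<nu> :: "'n \<Rightarrow> nat" assume "\<nu> \<in> UNIV - range (\<lambda>\<nu>. \<nu>(j := Suc (\<nu> j)))"
    moreover have "\<nu> = (\<nu>(j := \<nu> j - 1))(j := Suc ((\<nu>(j := \<nu> j - 1)) j))" if "\<nu> j \<noteq> 0"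
      using that by (auto simp: fun_eq_iff)
    ultimately have "\<nu> j = 0" by blast
    then show "g \<nu> = 0" by (rule assms)
  qed auto
  also have "\<dots> \<longleftrightarrow> ((\<lambda>\<nu>. g (\<nu>(j := Suc (\<nu> j)))) has_sum s) UNIV"
  proof (subst has_sum_reindex)
    show "inj (\<lambda>\<nu>::'n \<Rightarrow> nat. \<nu>(j := Suc (\<nu> j)))"
      by (rule injI) (metis fun_upd_same fun_upd_triv fun_upd_upd nat.inject)
  qed (simp add: o_def)
  finally show ?thesis .
qed

text \<open>
  The radius is kept: each point has some \<open>\<sigma> < \<rho>\<close> above its coordinates, and moving the \<open>j\<close>-th
  coordinate by less than the gap stays below \<open>\<sigma>\<close>, where the diagonal majorant applies.
\<close>

lemma has_pseries_partial_deriv: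
  fixes c :: "('n::finite \<Rightarrow> nat) \<Rightarrow> complex"
  assumes "has_pseries c f \<rho>"
  shows "has_pseries (\<lambda>\<nu>. of_nat (Suc (\<nu> j)) * c (\<nu>(j := Suc (\<nu> j)))) (partial_deriv j f) \<rho>"
  unfolding has_pseries_def
proof
  fix x :: "complex ^ 'n" assume "x \<in> polydisc \<rho>"
  then obtain \<sigma> where \<sigma>: "0 < \<sigma>" "\<sigma> < \<rho>" "\<And>j. norm (x $ j) < \<sigma>"
    by (rule polydisc_radius) blast
  define \<delta> where "\<delta> = (\<sigma> - norm (x $ j)) / 2"
  have \<delta>: "0 < \<delta>" using \<sigma>(3)[of j] by (simp add: \<delta>_def)
  have le: "norm ((x + axis j t) $ i) \<le> \<sigma>" if "norm t \<le> \<delta>" for t i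
  proof (cases "i = j")
    case True
    have "norm (x $ j + t) \<le> norm (x $ j) + \<delta>" using norm_triangle_ineq that by (meson add_left_mono order_trans)
    also have "\<dots> \<le> \<sigma>" using \<sigma>(3)[of j] by (simp add: \<delta>_def field_simps)
    finally show ?thesis by (simp add: True axis_def)
  qed (use \<sigma>(3)[of i] in \<open>simp add: axis_def\<close>)
  have "((\<lambda>\<nu>. c \<nu> * (of_nat (\<nu> j) * monomial (\<nu>(j := \<nu> j - 1)) (x + axis j 0))) has_sum
     deriv (\<lambda>t. f (x + axis j t)) 0) UNIV"
  proof (rule has_sum_termwise_derivative(2)[OF \<delta>])
    show "((\<lambda>\<nu>. c \<nu> * monomial \<nu> (x + axis j t)) has_sum f (x + axis j t)) UNIV" if "norm t \<le> \<delta>" for t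
    proof -
      have "x + axis j t \<in> polydisc \<rho>"
        using le[OF that] \<sigma>(2) by (force simp: polydisc_def intro: le_less_trans)
      then show ?thesis using assms by (simp add: has_pseries_def)
    qed
    show "norm (c \<nu> * monomial \<nu> (x + axis j t)) \<le> norm (c \<nu>) * \<sigma> ^ (\<Sum>j\<in>UNIV. \<nu> j)"
      if "norm t \<le> \<delta>" for t \<nu>
      unfolding norm_mult by (intro mult_left_mono norm_monomial_le le that) auto
    show "(\<lambda>\<nu>. norm (c \<nu>) * \<sigma> ^ (\<Sum>j\<in>UNIV. \<nu> j)) summable_on UNIV"
      using has_pseries_abs_summable assms \<sigma> by (metis less_imp_le)
    show "((\<lambda>t. c \<nu> * monomial \<nu> (x + axis j t)) has_field_derivative
       c \<nu> * (of_nat (\<nu> j) * monomial (\<nu>(j := \<nu> j - 1)) (x + axis j t))) (at t)" for \<nu> t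
      by (intro DERIV_cmult has_field_derivative_monomial_axis)
  qed
  then have "((\<lambda>\<nu>. c \<nu> * (of_nat (\<nu> j) * monomial (\<nu>(j := \<nu> j - 1)) x)) has_sum partial_deriv j f x) UNIV"
    by (simp add: partial_deriv_def axis_zero)
  also have "?this \<longleftrightarrow> ((\<lambda>\<nu>. of_nat (Suc (\<nu> j)) * c (\<nu>(j := Suc (\<nu> j))) * monomial \<nu> x) has_sum partial_deriv j f x) UNIV"
    by (subst has_sum_shift[of j]) (simp_all add: mult_ac del: of_nat_Suc)
  finally show "((\<lambda>\<nu>. of_nat (Suc (\<nu> j)) * c (\<nu>(j := Suc (\<nu> j))) * monomial \<nu> x) has_sum partial_deriv j f x) UNIV" .
qed

lemma has_pseries_cong:
  assumes "has_pseries c f \<rho>" "\<And>x. x \<in> polydisc \<rho> \<Longrightarrow> f x = g x"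
  shows "has_pseries c g \<rho>"
  using assms by (simp add: has_pseries_def)

lemma has_pseries_at_0: "has_pseries c f \<rho> \<Longrightarrow> 0 < \<rho> \<Longrightarrow> f 0 = c (\<lambda>_. 0)"
proof -
  assume *: "has_pseries c f \<rho>" "0 < \<rho>"
  then have "((\<lambda>\<nu>. c \<nu> * monomial \<nu> 0) has_sum f 0) UNIV"
    using zero_in_polydisc unfolding has_pseries_def by blast
  moreover have "((\<lambda>\<nu>. c \<nu> * monomial \<nu> 0) has_sum c (\<lambda>_. 0)) UNIV"
    by (rule has_sum_finite_neutralI[of "{\<lambda>_. 0}"]) (auto simp: monomial_zero)
  ultimately show ?thesis using has_sum_unique by blast
qed

text \<open>
  Coefficients are read off at the origin. Since the hypothesis concerns the zero function, it is
  inherited by all partial derivatives, so an induction on the degree reduces every coefficient to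
  the constant one.
\<close>

lemma has_pseries_zero_imp:
  fixes c :: "('n::finite \<Rightarrow> nat) \<Rightarrow> complex"
  assumes "has_pseries c (\<lambda>_. 0) \<rho>" "0 < \<rho>"
  shows "c \<nu> = 0"
  using assms(1)
proof (induction "\<Sum>j\<in>UNIV. \<nu> j" arbitrary: \<nu> c)
  case 0
  then have "\<nu> = (\<lambda>_. 0)" by auto
  then show ?case using has_pseries_at_0[OF "0.prems" assms(2)] by simp
next
  case (Suc k)
  then obtain j where j: "\<nu> j > 0" by (metis gr0I sum.neutral nat.distinct(1))
  define \<kappa> where "\<kappa> = \<nu>(j := \<nu> j - 1)"
  have \<nu>: "\<nu> = \<kappa>(j := Suc (\<kappa> j))" using j by (auto simp: \<kappa>_def fun_eq_iff)
  have "sum \<nu> UNIV = Suc (sum \<kappa> UNIV)"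
    unfolding \<nu> by (subst (1 2) sum.remove[of _ j]) auto
  then have k: "k = sum \<kappa> UNIV" using Suc.hyps(2) by simp
  have "partial_deriv j (\<lambda>_. 0) x = 0" for x :: "complex ^ 'n" by (simp add: partial_deriv_def)
  then have "has_pseries (\<lambda>\<nu>. of_nat (Suc (\<nu> j)) * c (\<nu>(j := Suc (\<nu> j)))) (\<lambda>_. 0) \<rho>"
    by (intro has_pseries_cong[OF has_pseries_partial_deriv[OF Suc.prems]])
  from Suc.hyps(1)[OF k this] show ?case using \<nu> by (simp del: of_nat_Suc)
qed

lemma has_pseries_unique:
  fixes c d :: "('n::finite \<Rightarrow> nat) \<Rightarrow> complex"
  assumes "has_pseries c f \<rho>" "has_pseries d f \<rho>" "0 < \<rho>"
  shows "c = d"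
proof
  fix \<nu>
  have "has_pseries (\<lambda>\<nu>. c \<nu> + (-1) * d \<nu>) (\<lambda>x. f x + (-1) * f x) \<rho>"
    by (intro has_pseries_add has_pseries_cmult assms)
  then have "c \<nu> + (-1) * d \<nu> = 0"
    using assms(3) by (intro has_pseries_zero_imp) (auto elim: has_pseries_cong)
  then show "c \<nu> = d \<nu>" by simp
qed


section \<open>Analyticity and the identity theorem\<close>

text \<open>
  The sum is finite, as binomial coefficients vanish outside the box below \<open>\<nu>\<close>; summing over all
  \<open>\<kappa>\<close> gives the double series of a re-expansion a rectangular index set. The generality in the ring
  serves the terms and their absolute values alike.
\<close>

lemma has_sum_binomial_prod:
  fixes u v :: "'n::finite \<Rightarrow> 'a :: {comm_semiring_1, topological_comm_monoid_add}"
  shows "((\<lambda>\<kappa>. \<Prod>j\<in>UNIV. of_nat (\<nu> j choose \<kappa> j) * u j ^ \<kappa> j * v j ^ (\<nu> j - \<kappa> j))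
           has_sum (\<Prod>j\<in>UNIV. (u j + v j) ^ \<nu> j)) UNIV"
proof (rule has_sum_finite_neutralI)
  show "finite (PiE UNIV (\<lambda>j. {..\<nu> j}))" by (intro finite_PiE) auto
  show "(\<Prod>j\<in>UNIV. (u j + v j) ^ \<nu> j) =
    (\<Sum>\<kappa>\<in>PiE UNIV (\<lambda>j. {..\<nu> j}). \<Prod>j\<in>UNIV. of_nat (\<nu> j choose \<kappa> j) * u j ^ \<kappa> j * v j ^ (\<nu> j - \<kappa> j))"
    unfolding binomial_ring by (subst prod_sum_PiE) auto
  show "(\<Prod>j\<in>UNIV. of_nat (\<nu> j choose \<kappa> j) * u j ^ \<kappa> j * v j ^ (\<nu> j - \<kappa> j)) = 0"
    if "\<kappa> \<in> UNIV - PiE UNIV (\<lambda>j. {..\<nu> j})" for \<kappa>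
  proof -
    from that obtain j where "\<kappa> j > \<nu> j" by (auto simp: PiE_def Pi_def not_le)
    then have "of_nat (\<nu> j choose \<kappa> j) * u j ^ \<kappa> j * v j ^ (\<nu> j - \<kappa> j) = 0"
      by (simp add: binomial_eq_0)
    then show ?thesis by (intro prod_zero) auto
  qed
qed auto

text \<open>
  Expand every monomial in \<open>x = a + h\<close> binomially and interchange the two summations. The
  interchange is legitimate because the absolute values of row \<open>\<nu>\<close> add up to \<open>\<bar>c\<^sub>\<nu>\<bar>\<close> times a product
  of powers of \<open>\<bar>a\<^sub>j\<bar> + \<bar>h\<^sub>j\<bar>\<close>, which for small \<open>h\<close> still lies in the range of the diagonal majorant.
\<close>

lemma has_pseries_imp_mv_analytic:
  fixes c :: "('n::finite \<Rightarrow> nat) \<Rightarrow> complex"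
  assumes ps: "has_pseries c f \<rho>"
  shows "mv_analytic_on f (polydisc \<rho>)"
  unfolding mv_analytic_on_def
proof
  fix a :: "complex ^ 'n" assume a: "a \<in> polydisc \<rho>"
  then obtain \<sigma> where \<sigma>: "0 < \<sigma>" "\<sigma> < \<rho>" "\<And>j. norm (a $ j) < \<sigma>"
    by (rule polydisc_radius) blast
  define r where "r = (\<rho> - \<sigma>) / 2"
  have r: "r > 0" "\<sigma> + r < \<rho>" using \<sigma> by (auto simp: r_def field_simps)
  define b where "b \<nu> \<kappa> = c \<nu> * (\<Prod>j\<in>UNIV. of_nat (\<nu> j choose \<kappa> j) * (a $ j) ^ (\<nu> j - \<kappa> j))" for \<nu> \<kappa>
  have eq: "b \<nu> \<kappa> * monomial \<kappa> h =
      c \<nu> * (\<Prod>j\<in>UNIV. of_nat (\<nu> j choose \<kappa> j) * (h $ j) ^ \<kappa> j * (a $ j) ^ (\<nu> j - \<kappa> j))" for \<nu> \<kappa> h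
    by (simp add: b_def monomial_def prod.distrib mult_ac)
  have summable: "(\<lambda>(\<nu>, \<kappa>). b \<nu> \<kappa> * monomial \<kappa> h) summable_on UNIV \<times> UNIV" if h: "\<And>j. norm (h $ j) < r" for h
  proof (rule abs_summable_summable, rule summable_on_SigmaI)
    show "((\<lambda>\<kappa>. norm (case (\<nu>, \<kappa>) of (\<nu>, \<kappa>) \<Rightarrow> b \<nu> \<kappa> * monomial \<kappa> h)) has_sum
       norm (c \<nu>) * (\<Prod>j\<in>UNIV. (norm (h $ j) + norm (a $ j)) ^ \<nu> j)) UNIV" for \<nu>
      unfolding prod.case eq norm_mult prod_norm[symmetric] norm_power norm_of_nat
      by (intro has_sum_cmult_right has_sum_binomial_prod)
    show "(\<lambda>\<nu>. norm (c \<nu>) * (\<Prod>j\<in>UNIV. (norm (h $ j) + norm (a $ j)) ^ \<nu> j)) summable_on UNIV"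
    proof (rule summable_on_comparison_test)
      show "(\<lambda>\<nu>. norm (c \<nu>) * (\<sigma> + r) ^ (\<Sum>j\<in>UNIV. \<nu> j)) summable_on UNIV"
        using r \<sigma> by (intro has_pseries_abs_summable[OF ps]) auto
      show "norm (c \<nu>) * (\<Prod>j\<in>UNIV. (norm (h $ j) + norm (a $ j)) ^ \<nu> j) \<le>
          norm (c \<nu>) * (\<sigma> + r) ^ (\<Sum>j\<in>UNIV. \<nu> j)" for \<nu>
      proof -
        have "norm (h $ j) + norm (a $ j) \<le> \<sigma> + r" for j
          using h[of j] \<sigma>(3)[of j] by linarith
        then show ?thesis
          unfolding power_sum by (intro mult_left_mono prod_mono conjI power_mono) auto
      qed
    qed (auto intro!: mult_nonneg_nonneg prod_nonneg)
  qed auto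
  \<comment> \<open>Summability of a column is read off at a point \<open>h\<close> all of whose monomials are nonzero.\<close>
  have summable_b: "(\<lambda>\<nu>. b \<nu> \<kappa>) summable_on UNIV" for \<kappa>
  proof -
    define h :: "complex ^ 'n" where "h = (\<chi> j. of_real (r / 2))"
    have "(\<lambda>(\<nu>, \<kappa>). b \<nu> \<kappa> * monomial \<kappa> h) summable_on UNIV \<times> UNIV"
      using r by (intro summable) (auto simp: h_def)
    then have "(\<lambda>(\<kappa>, \<nu>). b \<nu> \<kappa> * monomial \<kappa> h) summable_on UNIV \<times> UNIV"
      by (subst (asm) summable_on_swap) (simp add: case_prod_unfold)
    from summable_on_SigmaD1[OF this, of \<kappa>]
    have "(\<lambda>\<nu>. b \<nu> \<kappa> * monomial \<kappa> h) summable_on UNIV" by simp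
    moreover have "monomial \<kappa> h \<noteq> 0" using r by (auto simp: h_def monomial_def)
    ultimately show ?thesis by (simp add: summable_on_cmult_left')
  qed
  show "\<exists>r>0. \<exists>d. \<forall>x\<in>ball a r. ((\<lambda>\<kappa>. d \<kappa> * monomial \<kappa> (x - a)) has_sum f x) UNIV"
  proof (intro exI conjI ballI)
    fix x assume x: "x \<in> ball a r"
    define h where "h = x - a"
    have h: "norm (h $ j) < r" for j
      using x Finite_Cartesian_Product.norm_nth_le[of h j]
      by (simp add: h_def dist_norm norm_minus_commute)
    have "x \<in> polydisc \<rho>"
    proof -
      have "norm (x $ j) < \<rho>" for j
        using norm_triangle_ineq[of "a $ j" "h $ j"] h[of j] \<sigma>(3)[of j] r by (simp add: h_def)
      then show ?thesis by (simp add: polydisc_def)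
    qed
    then have fx: "((\<lambda>\<nu>. c \<nu> * monomial \<nu> x) has_sum f x) UNIV"
      using ps by (simp add: has_pseries_def)
    have "((\<lambda>(\<nu>, \<kappa>). b \<nu> \<kappa> * monomial \<kappa> h) has_sum f x) (UNIV \<times> UNIV)"
    proof (rule has_sum_SigmaI[OF _ fx summable])
      fix \<nu>
      have "((\<lambda>\<kappa>. b \<nu> \<kappa> * monomial \<kappa> h) has_sum (c \<nu> * (\<Prod>j\<in>UNIV. (h $ j + a $ j) ^ \<nu> j))) UNIV"
        unfolding eq by (intro has_sum_cmult_right has_sum_binomial_prod)
      then show "((\<lambda>\<kappa>. case (\<nu>, \<kappa>) of (\<nu>, \<kappa>) \<Rightarrow> b \<nu> \<kappa> * monomial \<kappa> h) has_sum c \<nu> * monomial \<nu> x) UNIV"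
        by (simp add: h_def monomial_def)
    qed (rule h)
    then have "((\<lambda>(\<kappa>, \<nu>). b \<nu> \<kappa> * monomial \<kappa> h) has_sum f x) (UNIV \<times> UNIV)"
      by (subst (asm) has_sum_swap) (simp add: case_prod_unfold)
    then show "((\<lambda>\<kappa>. (\<Sum>\<^sub>\<infinity>\<nu>. b \<nu> \<kappa>) * monomial \<kappa> (x - a)) has_sum f x) UNIV"
      unfolding h_def[symmetric]
    proof (rule has_sum_SigmaD)
      show "((\<lambda>\<nu>. case (\<kappa>, \<nu>) of (\<kappa>, \<nu>) \<Rightarrow> b \<nu> \<kappa> * monomial \<kappa> h) has_sum
          (\<Sum>\<^sub>\<infinity>\<nu>. b \<nu> \<kappa>) * monomial \<kappa> h) UNIV" for \<kappa>
        using summable_b by (simp add: has_sum_cmult_left)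
    qed
  qed (use r in auto)
qed

lemma norm_vector_scalar_mult: "norm (t *s v) = norm t * norm (v :: complex ^ 'n::finite)"
  by (simp add: norm_vec_def vector_scalar_mult_def norm_mult L2_set_right_distrib)

text \<open>
  On a complex line through the centre the series becomes a series in powers of \<open>t\<close> with indices in
  \<open>\<nat>\<^sup>n\<close>; its value at one \<open>t\<close> of larger modulus majorises it.
\<close>

lemma mv_analytic_on_line:
  fixes b v :: "complex ^ 'n::finite"
  assumes "mv_analytic_on f U" "b + t0 *s v \<in> U"
  shows "(\<lambda>t. f (b + t *s v)) field_differentiable at t0"
proof -
  define a where "a = b + t0 *s v"
  obtain r c where r: "r > 0" and c: "\<And>x. x \<in> ball a r \<Longrightarrow> ((\<lambda>\<nu>. c \<nu> * monomial \<nu> (x - a)) has_sum f x) UNIV"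
    using assms unfolding mv_analytic_on_def a_def by blast
  \<comment> \<open>Adding \<open>1\<close> covers \<open>v = 0\<close>.\<close>
  define \<delta> where "\<delta> = r / (2 * (norm v + 1))"
  have \<delta>: "\<delta> > 0" using r by (auto simp: \<delta>_def intro!: divide_pos_pos mult_pos_pos add_nonneg_pos)
  have "\<delta> * norm v < r"
  proof -
    have "\<delta> * norm v \<le> \<delta> * (norm v + 1)" using \<delta> by (intro mult_left_mono) auto
    also have "\<dots> = r / 2" using norm_ge_zero[of v] unfolding \<delta>_def by (simp add: field_simps add_nonneg_eq_0_iff)
    also have "\<dots> < r" using r by simp
    finally show ?thesis .
  qed
  have in_ball: "a + t *s v \<in> ball a r" if "norm t \<le> \<delta>" for t
  proof -
    have "norm t * norm v \<le> \<delta> * norm v" using that by (intro mult_right_mono) auto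
    also have "\<dots> < r" by fact
    finally show ?thesis by (simp add: dist_norm norm_vector_scalar_mult)
  qed
  have eq: "monomial \<nu> (a + t *s v - a) = t ^ (\<Sum>j\<in>UNIV. \<nu> j) * monomial \<nu> v" for t \<nu>
    by (simp add: vector_scalar_mult_def monomial_scale)
  have sums: "((\<lambda>\<nu>. c \<nu> * (t ^ (\<Sum>j\<in>UNIV. \<nu> j) * monomial \<nu> v)) has_sum f (a + t *s v)) UNIV"
    if "norm t \<le> \<delta>" for t
    using c[OF in_ball[OF that]] unfolding eq .
  have pow: "((\<lambda>t::complex. t ^ n) has_field_derivative of_nat n * t ^ (n - 1)) (at t)" for n t
    using DERIV_power[OF DERIV_ident, of n t] by simp
  have "(\<lambda>t. f (a + t *s v)) field_differentiable at 0"
  proof (rule has_sum_termwise_derivative(1)[OF \<delta> sums])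
    have "(\<lambda>\<nu>. c \<nu> * (of_real \<delta> ^ (\<Sum>j\<in>UNIV. \<nu> j) * monomial \<nu> v)) summable_on UNIV"
      by (rule has_sum_imp_summable[OF sums]) (use \<delta> in simp)
    then show "(\<lambda>\<nu>. norm (c \<nu> * (of_real \<delta> ^ (\<Sum>j\<in>UNIV. \<nu> j) * monomial \<nu> v))) summable_on UNIV"
      by (rule summable_on_iff_abs_summable_on_complex[THEN iffD1])
    show "norm (c \<nu> * (t ^ (\<Sum>j\<in>UNIV. \<nu> j) * monomial \<nu> v)) \<le>
       norm (c \<nu> * (of_real \<delta> ^ (\<Sum>j\<in>UNIV. \<nu> j) * monomial \<nu> v))" if "norm t \<le> \<delta>" for \<nu> t
      unfolding norm_mult norm_power using that \<delta>
      by (intro mult_left_mono mult_right_mono power_mono) auto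
    show "((\<lambda>t. c \<nu> * (t ^ (\<Sum>j\<in>UNIV. \<nu> j) * monomial \<nu> v)) has_field_derivative
       c \<nu> * (of_nat (\<Sum>j\<in>UNIV. \<nu> j) * t ^ ((\<Sum>j\<in>UNIV. \<nu> j) - 1) * monomial \<nu> v)) (at t)" for \<nu> t
      by (intro DERIV_cmult DERIV_cmult_right) (rule pow)
  qed
  then obtain D where "((\<lambda>t. f (a + t *s v)) has_field_derivative D) (at 0)"
    by (auto simp: field_differentiable_def)
  then have "((\<lambda>t. f (a + (t - t0) *s v)) has_field_derivative D) (at t0)"
    using DERIV_shift[of "\<lambda>t. f (a + t *s v)" D t0 "- t0"] by simp
  moreover have "a + (t - t0) *s v = b + t *s v" for t
    by (simp add: a_def vector_scalar_mult_def Finite_Cartesian_Product.vec_eq_iff algebra_simps)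
  ultimately show ?thesis by (auto simp only: field_differentiable_def)
qed

text \<open>
  The line through \<open>b\<close> and \<open>x\<close> meets the ball in a convex set of parameters that contains \<open>0\<close>
  (the point \<open>b\<close>) and \<open>1\<close> (the point \<open>x\<close>), so the identity theorem in one variable applies.
\<close>

lemma vanishing_on_ball:
  fixes G :: "complex ^ 'n::finite \<Rightarrow> complex"
  assumes hol: "\<And>b v t. b + t *s v \<in> ball a r \<Longrightarrow> (\<lambda>t. G (b + t *s v)) field_differentiable at t"
    and b: "b \<in> ball a r" and ev: "\<forall>\<^sub>F x in nhds b. G x = 0" and x: "x \<in> ball a r"
  shows "G x = 0"
proof -
  define w where "w = x - b"
  define S where "S = (\<lambda>t. t *s w) -` ball (a - b) r"
  have lin: "linear (\<lambda>t. t *s w)"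
    by (rule linearI) (auto simp: Finite_Cartesian_Product.vec_eq_iff algebra_simps)
  then have cont: "continuous_on UNIV (\<lambda>t. t *s w)"
    using linear_continuous_on linear_conv_bounded_linear by blast
  have S: "t \<in> S \<longleftrightarrow> b + t *s w \<in> ball a r" for t
    by (simp add: S_def dist_norm algebra_simps)
  have openS: "open S"
    unfolding S_def using cont by (simp add: continuous_on_open_vimage)
  have conv: "convex S"
    unfolding S_def by (intro convex_linear_vimage lin convex_ball)
  obtain V where V: "open V" "b \<in> V" "\<And>y. y \<in> V \<Longrightarrow> G y = 0"
    using ev by (auto simp: eventually_nhds)
  define S0 where "S0 = S \<inter> (\<lambda>t. b + t *s w) -` V"
  have openS0: "open S0"
    unfolding S0_def using cont openS V(1)
    by (intro open_Int) (auto intro!: open_vimage continuous_intros simp: continuous_on_eq_continuous_within)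
  have 01: "b + 0 *s w = b" "b + 1 *s w = x" by (auto simp: w_def)
  have "G (b + 1 *s w) = 0"
  proof (rule analytic_continuation_open[of S0 S "\<lambda>t. G (b + t *s w)" "\<lambda>_. 0"])
    have "0 \<in> S0" using b V(2) by (simp add: S0_def S)
    then show "S0 \<noteq> {}" by blast
    show "(\<lambda>t. G (b + t *s w)) holomorphic_on S"
      using hol S openS by (auto simp: holomorphic_on_def intro: field_differentiable_at_within)
    show "1 \<in> S" using x 01 S by simp
  qed (use openS openS0 conv V convex_connected in \<open>auto simp: S0_def\<close>)
  then show ?thesis using 01 by simp
qed

text \<open>
  The points near which \<open>G\<close> vanishes form an open set whose complement in \<open>U\<close> is open as well.
  Assuming holomorphy along complex lines only makes the class of admissible \<open>G\<close> visibly closed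
  under sums and products, so the theorem applies to polynomial expressions in an analytic function
  without multiplying power series.
\<close>

lemma identity_theorem_lines:
  fixes G :: "complex ^ 'n::finite \<Rightarrow> complex"
  assumes U: "open U" "connected U" "0 \<in> U"
    and hol: "\<And>b v t. b + t *s v \<in> U \<Longrightarrow> (\<lambda>t. G (b + t *s v)) field_differentiable at t"
    and ev: "\<forall>\<^sub>F x in nhds 0. G x = 0" and x: "x \<in> U"
  shows "G x = 0"
proof -
  define Z where "Z = {a\<in>U. \<forall>\<^sub>F x in nhds a. G x = 0}"
  have zero: "G y = 0" if "ball a r \<subseteq> U" "b \<in> ball a r" "b \<in> Z" "y \<in> ball a r" for a r b y
    using that hol by (intro vanishing_on_ball[of a r G b]) (auto simp: Z_def)
  have "open Z"
    unfolding open_subopen[of Z]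
  proof (intro ballI)
    fix a assume "a \<in> Z"
    then obtain V where "open V" "a \<in> V" "\<And>y. y \<in> V \<Longrightarrow> G y = 0"
      by (auto simp: Z_def eventually_nhds)
    then show "\<exists>T. open T \<and> a \<in> T \<and> T \<subseteq> Z"
      using U(1) \<open>a \<in> Z\<close> by (intro exI[of _ "V \<inter> U"]) (auto simp: Z_def eventually_nhds)
  qed
  moreover have "open (U - Z)"
    unfolding open_subopen[of "U - Z"]
  proof (intro ballI)
    fix a assume a: "a \<in> U - Z"
    then obtain r where r: "r > 0" "ball a r \<subseteq> U" using U(1) openE by blast
    have "b \<notin> Z" if "b \<in> ball a r" for b
    proof
      assume "b \<in> Z"
      then have "\<forall>y\<in>ball a r. G y = 0" using zero r(2) that by blast
      then have "\<forall>\<^sub>F x in nhds a. G x = 0"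
        using r(1) by (auto simp: eventually_nhds intro!: exI[of _ "ball a r"])
      then show False using a by (auto simp: Z_def)
    qed
    then show "\<exists>T. open T \<and> a \<in> T \<and> T \<subseteq> U - Z"
      using r by (intro exI[of _ "ball a r"]) auto
  qed
  moreover have "0 \<in> Z" using U(3) ev by (simp add: Z_def)
  ultimately have "U - Z = {}"
    using U(2,3) connectedD[of U Z "U - Z"] by (auto simp: Z_def)
  then have "x \<in> Z" using x by auto
  then show ?thesis by (auto simp: Z_def dest: eventually_nhds_x_imp_x)
qed


section \<open>The Mellin system as a recurrence for coefficients\<close>

text \<open>
  Euler operators are diagonal on monomials; everything about the left-hand sides of the system
  follows from this.
\<close>

lemma has_pseries_theta:
  assumes "has_pseries c f \<rho>"
  shows "has_pseries (\<lambda>\<nu>. of_nat (\<nu> j) * c \<nu>) (theta j f) \<rho>"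
  unfolding has_pseries_def
proof
  fix x :: "complex ^ 'a" assume "x \<in> polydisc \<rho>"
  then have "((\<lambda>\<nu>. of_nat (Suc (\<nu> j)) * c (\<nu>(j := Suc (\<nu> j))) * monomial \<nu> x) has_sum partial_deriv j f x) UNIV"
    using has_pseries_partial_deriv[OF assms, of j] unfolding has_pseries_def by blast
  from has_sum_cmult_right[OF this, of "x $ j"]
  have "((\<lambda>\<nu>. of_nat (Suc (\<nu> j)) * c (\<nu>(j := Suc (\<nu> j))) * monomial (\<nu>(j := Suc (\<nu> j))) x) has_sum theta j f x) UNIV"
    by (simp add: theta_def monomial_Suc mult_ac del: of_nat_Suc)
  then show "((\<lambda>\<nu>. of_nat (\<nu> j) * c \<nu> * monomial \<nu> x) has_sum theta j f x) UNIV"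
    by (subst has_sum_shift[of j]) (auto simp del: of_nat_Suc)
qed

lemma has_pseries_euler_op:
  assumes "has_pseries c f \<rho>"
  shows "has_pseries (\<lambda>\<nu>. (of_nat (\<Sum>j\<in>UNIV. a j * \<nu> j) + z) * c \<nu>) (euler_op a z f) \<rho>"
proof -
  have "has_pseries (\<lambda>\<nu>. (\<Sum>j\<in>UNIV. of_nat (a j) * (of_nat (\<nu> j) * c \<nu>)) + z * c \<nu>)
     (\<lambda>x. (\<Sum>j\<in>UNIV. of_nat (a j) * theta j f x) + z * f x) \<rho>"
    by (intro has_pseries_add has_pseries_sum has_pseries_cmult has_pseries_theta assms)
  then show ?thesis
    by (simp add: euler_op_def[abs_def] sum_distrib_right distrib_right mult.assoc)
qed

lemma has_pseries_foldr_euler_op: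
  assumes "has_pseries c f \<rho>"
  shows "has_pseries (\<lambda>\<nu>. (\<Prod>k<n. of_nat (\<Sum>j\<in>UNIV. a j * \<nu> j) + z k) * c \<nu>)
           (foldr (\<lambda>k. euler_op a (z k)) [0..<n] f) \<rho>"
proof -
  have "has_pseries (\<lambda>\<nu>. (\<Prod>k\<leftarrow>ks. of_nat (\<Sum>j\<in>UNIV. a j * \<nu> j) + z k) * c \<nu>)
           (foldr (\<lambda>k. euler_op a (z k)) ks f) \<rho>" for ks
  proof (induction ks)
    case (Cons k ks)
    from has_pseries_euler_op[OF this, of a "z k"] show ?case by (simp add: mult.assoc)
  qed (use assms in simp)
  from this[of "[0..<n]"] show ?thesis
    by (simp add: prod.distinct_set_conv_list[of "[0..<n]", symmetric] atLeast0LessThan)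
qed

lemma has_pseries_partial_deriv_power:
  assumes "has_pseries c f \<rho>"
  shows "has_pseries (\<lambda>\<nu>. pochhammer (of_nat (\<nu> j) + 1) k * c (\<nu>(j := \<nu> j + k)))
           ((partial_deriv j ^^ k) f) \<rho>"
proof (induction k)
  case (Suc k)
  from has_pseries_partial_deriv[OF this, of j]
  show ?case by (simp add: pochhammer_rec add_ac mult_ac fun_upd_def cong: if_cong)
qed (use assms in simp)

text \<open>
  The eigenvalue on \<open>x\<^sup>\<nu>\<close> of the operator on the left-hand side of the \<open>j\<close>-th equation.
\<close>

definition mellin_factor :: "nat \<Rightarrow> ('n::finite \<Rightarrow> nat) \<Rightarrow> 'n \<Rightarrow> ('n \<Rightarrow> nat) \<Rightarrow> complex" where
  "mellin_factor m \<mu> j \<nu> =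
     (\<Prod>k<\<mu> j. of_nat (\<Sum>i\<in>UNIV. \<mu> i * \<nu> i) + (of_nat (m * k) + 1)) *
     (\<Prod>k<m - \<mu> j. of_nat (\<Sum>i\<in>UNIV. (m - \<mu> i) * \<nu> i) + (of_nat (m * k) - 1))"

text \<open>
  The \<open>\<nu>\<close>-th coefficient of the \<open>j\<close>-th equation; the Pochhammer symbol comes from differentiating
  \<open>m\<close> times in \<open>x\<^sub>j\<close>.
\<close>

definition mellin_recurrence :: "nat \<Rightarrow> ('n::finite \<Rightarrow> nat) \<Rightarrow> (('n \<Rightarrow> nat) \<Rightarrow> complex) \<Rightarrow> bool" where
  "mellin_recurrence m \<mu> c \<longleftrightarrow> (\<forall>j \<nu>. mellin_factor m \<mu> j \<nu> * c \<nu> =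
     (-1) ^ \<mu> j * of_nat m ^ m * (pochhammer (of_nat (\<nu> j) + 1) m * c (\<nu>(j := \<nu> j + m))))"

lemma has_pseries_mellin_lhs:
  assumes "has_pseries c f \<rho>"
  shows "has_pseries (\<lambda>\<nu>. mellin_factor m \<mu> j \<nu> * c \<nu>) (mellin_lhs m \<mu> j f) \<rho>"
  unfolding mellin_lhs_def mellin_factor_def mult.assoc
  by (intro has_pseries_foldr_euler_op assms)

lemma mellin_solution_imp_recurrence:
  fixes c :: "('n::finite \<Rightarrow> nat) \<Rightarrow> complex"
  assumes ps: "has_pseries c f \<rho>" and "0 < \<rho>" and sol: "mellin_solution_on m \<mu> U f" and sub: "polydisc \<rho> \<subseteq> U"
  shows "mellin_recurrence m \<mu> c"
  unfolding mellin_recurrence_def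
proof (intro allI)
  fix j \<nu>
  have "has_pseries (\<lambda>\<nu>. mellin_factor m \<mu> j \<nu> * c \<nu>)
      (\<lambda>x. (-1) ^ \<mu> j * of_nat m ^ m * (partial_deriv j ^^ m) f x) \<rho>"
    using sol sub by (intro has_pseries_cong[OF has_pseries_mellin_lhs[OF ps]]) (auto simp: mellin_solution_on_def)
  from has_pseries_unique[OF this has_pseries_cmult[OF has_pseries_partial_deriv_power[OF ps, of j m],
        of "(-1) ^ \<mu> j * of_nat m ^ m"] \<open>0 < \<rho>\<close>]
  show "mellin_factor m \<mu> j \<nu> * c \<nu> =
     (-1) ^ \<mu> j * of_nat m ^ m * (pochhammer (of_nat (\<nu> j) + 1) m * c (\<nu>(j := \<nu> j + m)))"
    by (rule fun_cong)
qed

lemma recurrence_imp_mellin_solution: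
  fixes c :: "('n::finite \<Rightarrow> nat) \<Rightarrow> complex"
  assumes ps: "has_pseries c f \<rho>" and rec: "mellin_recurrence m \<mu> c"
  shows "mellin_solution_on m \<mu> (polydisc \<rho>) f"
  unfolding mellin_solution_on_def
proof (intro conjI ballI allI has_pseries_imp_mv_analytic[OF ps])
  fix x :: "complex ^ 'n" and j assume x: "x \<in> polydisc \<rho>"
  show "mellin_lhs m \<mu> j f x = (-1) ^ \<mu> j * of_nat m ^ m * (partial_deriv j ^^ m) f x"
  proof (rule has_sum_unique)
    show "((\<lambda>\<nu>. mellin_factor m \<mu> j \<nu> * c \<nu> * monomial \<nu> x) has_sum mellin_lhs m \<mu> j f x) UNIV"
      using has_pseries_mellin_lhs[OF ps] x unfolding has_pseries_def by blast
    show "((\<lambda>\<nu>. mellin_factor m \<mu> j \<nu> * c \<nu> * monomial \<nu> x) has_sum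
        (-1) ^ \<mu> j * of_nat m ^ m * (partial_deriv j ^^ m) f x) UNIV"
      using has_pseries_cmult[OF has_pseries_partial_deriv_power[OF ps, of j m],
        of "(-1) ^ \<mu> j * of_nat m ^ m"] x rec unfolding has_pseries_def mellin_recurrence_def by simp
  qed
qed

lemma mv_analytic_imp_has_pseries:
  fixes U :: "(complex ^ 'n::finite) set"
  assumes "mv_analytic_on f U" "open U" "0 \<in> U"
  obtains c \<rho> where "0 < \<rho>" "polydisc \<rho> \<subseteq> U" "has_pseries c f \<rho>"
proof -
  obtain r c where r: "r > 0" "\<And>x. x \<in> ball 0 r \<Longrightarrow> ((\<lambda>\<nu>. c \<nu> * monomial \<nu> x) has_sum f x) UNIV"
    using assms unfolding mv_analytic_on_def by (metis diff_zero)
  obtain \<rho> :: real where "0 < \<rho>" "polydisc \<rho> \<subseteq> U \<inter> ball 0 r"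
    using polydisc_in_open[of "U \<inter> ball 0 r"] assms r(1) by auto
  then show ?thesis using that r(2) unfolding has_pseries_def by blast
qed


section \<open>The coefficients of powers of the root\<close>

abbreviation mdeg :: "('n::finite \<Rightarrow> nat) \<Rightarrow> nat" where
  "mdeg \<nu> \<equiv> (\<Sum>j\<in>UNIV. \<nu> j)"

abbreviation weight :: "('n::finite \<Rightarrow> nat) \<Rightarrow> ('n \<Rightarrow> nat) \<Rightarrow> nat" where
  "weight \<mu> \<nu> \<equiv> (\<Sum>j\<in>UNIV. \<mu> j * \<nu> j)"

abbreviation mfact :: "('n::finite \<Rightarrow> nat) \<Rightarrow> complex" where
  "mfact \<nu> \<equiv> (\<Prod>j\<in>UNIV. fact (\<nu> j))"

text \<open>
  The coefficient of \<open>x\<^sup>\<nu>\<close> in the \<open>s\<close>-th power of the principal solution, as predicted by Lagrange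
  inversion: with \<open>N = \<Sum>\<^sub>j \<mu>\<^sub>j \<nu>\<^sub>j\<close> the last factor is \<open>s / (N + s)\<close> times the product of
  \<open>N + s - m u\<close> over \<open>0 \<le> u < \<bar>\<nu>\<bar>\<close>, with the division carried out. In this form it is a polynomial in
  \<open>s\<close>, and \<open>s\<close> is a complex number for that reason.
\<close>

definition root_coeff :: "nat \<Rightarrow> ('n::finite \<Rightarrow> nat) \<Rightarrow> complex \<Rightarrow> ('n \<Rightarrow> nat) \<Rightarrow> complex" where
  "root_coeff m \<mu> s \<nu> = (- 1 / of_nat m) ^ mdeg \<nu> / mfact \<nu> *
     (case mdeg \<nu> of 0 \<Rightarrow> 1 | Suc k \<Rightarrow> s * (\<Prod>u=1..k. of_nat (weight \<mu> \<nu>) + s - of_nat m * of_nat u))"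

lemma mdeg_eq_0_iff: "mdeg \<nu> = 0 \<longleftrightarrow> \<nu> = (\<lambda>_. 0)"
  by (auto simp: fun_eq_iff)

lemma mdeg_pred: "\<nu> j > 0 \<Longrightarrow> mdeg \<nu> = Suc (mdeg (\<nu>(j := \<nu> j - 1)))"
  by (subst (1 2) sum.remove[of _ j]) auto

lemma weight_pred: "\<nu> j > 0 \<Longrightarrow> weight \<mu> \<nu> = \<mu> j + weight \<mu> (\<nu>(j := \<nu> j - 1))"
  by (cases "\<nu> j") (simp_all add: sum.remove[of UNIV j])

lemma mfact_pred: "\<nu> j > 0 \<Longrightarrow> mfact \<nu> = of_nat (\<nu> j) * mfact (\<nu>(j := \<nu> j - 1))"
  by (subst (1 2) prod.remove[of _ j]) (auto simp: fact_reduce)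

lemma mfact_nonzero: "mfact \<nu> \<noteq> 0"
  by simp

lemma root_coeff_0: "root_coeff m \<mu> 0 \<nu> = (if \<nu> = (\<lambda>_. 0) then 1 else 0)"
proof (cases "mdeg \<nu>")
  case 0
  then show ?thesis using mdeg_eq_0_iff[of \<nu>] by (auto simp: root_coeff_def)
next
  case (Suc k)
  then show ?thesis using mdeg_eq_0_iff[of \<nu>] by (auto simp: root_coeff_def)
qed

text \<open>
  This is the coefficient form of \<open>Y\<^bsup>s+m\<^esup> - Y\<^bsup>s\<^esup> = - \<Sum>\<^sub>j x\<^sub>j Y\<^bsup>s+\<mu>\<^sub>j\<^esup>\<close>. All terms share the product
  \<open>Q\<close> of \<open>N + s - m u\<close> over \<open>1 \<le> u \<le> \<bar>\<nu>\<bar> - 2\<close>: on the left the two products differ only in one factor at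
  either end, on the right \<open>N\<close> drops by \<open>\<mu>\<^sub>j\<close> while \<open>s\<close> grows by \<open>\<mu>\<^sub>j\<close>. What remains is a linear identity.
\<close>

lemma root_coeff_difference:
  assumes "0 < m"
  shows "root_coeff m \<mu> (s + of_nat m) \<nu> - root_coeff m \<mu> s \<nu> =
    - (\<Sum>j | \<nu> j > 0. root_coeff m \<mu> (s + of_nat (\<mu> j)) (\<nu>(j := \<nu> j - 1)))"
proof (cases "mdeg \<nu>")
  case 0
  then show ?thesis by (auto simp: root_coeff_def)
next
  case (Suc k)
  define N :: complex where "N = of_nat (weight \<mu> \<nu>)"
  define M :: complex where "M = of_nat m"
  have M: "M \<noteq> 0" using assms by (simp add: M_def)
  define e where "e = (- 1 / M) ^ k / mfact \<nu>"
  define G where "G j = (case k of 0 \<Rightarrow> 1 | Suc l \<Rightarrow>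
      (s + of_nat (\<mu> j)) * (\<Prod>u=1..l. N + s - M * of_nat u))" for j
  have term_eq: "root_coeff m \<mu> (s + of_nat (\<mu> j)) (\<nu>(j := \<nu> j - 1)) = e * (of_nat (\<nu> j) * G j)"
    if j: "\<nu> j > 0" for j
  proof -
    define \<kappa> where "\<kappa> = \<nu>(j := \<nu> j - 1)"
    have k: "mdeg \<kappa> = k" using mdeg_pred[of \<nu> j, OF j] Suc by (simp add: \<kappa>_def)
    have w: "of_nat (weight \<mu> \<kappa>) + (s + of_nat (\<mu> j)) = N + s"
      using weight_pred[of \<nu> j \<mu>, OF j] unfolding N_def \<kappa>_def by simp
    have f: "1 / mfact \<kappa> = of_nat (\<nu> j) / mfact \<nu>"
      using mfact_pred[of \<nu> j, OF j] j mfact_nonzero[of \<kappa>] unfolding \<kappa>_def by (simp add: field_simps)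
    have "root_coeff m \<mu> (s + of_nat (\<mu> j)) \<kappa> = (- 1 / M) ^ k * (1 / mfact \<kappa>) * G j"
      unfolding root_coeff_def G_def k w M_def by simp
    then show ?thesis unfolding f by (simp only: \<kappa>_def e_def) (simp only: times_divide_eq_left times_divide_eq_right mult_ac)
  qed
  have rhs: "(\<Sum>j | \<nu> j > 0. root_coeff m \<mu> (s + of_nat (\<mu> j)) (\<nu>(j := \<nu> j - 1))) =
      e * (\<Sum>j\<in>UNIV. of_nat (\<nu> j) * G j)"
    unfolding sum_distrib_left by (rule sum.mono_neutral_cong_left) (auto simp: term_eq[unfolded One_nat_def])
  have lhs: "root_coeff m \<mu> (s + M) \<nu> - root_coeff m \<mu> s \<nu> =
     (- 1 / M) * e * ((s + M) * (\<Prod>u=1..k. N + (s + M) - M * of_nat u) - s * (\<Prod>u=1..k. N + s - M * of_nat u))"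
    unfolding root_coeff_def Suc N_def[symmetric] M_def[symmetric] by (simp add: e_def algebra_simps)
  have "(- 1 / M) * e * ((s + M) * (\<Prod>u=1..k. N + (s + M) - M * of_nat u) - s * (\<Prod>u=1..k. N + s - M * of_nat u))
      = - (e * (\<Sum>j\<in>UNIV. of_nat (\<nu> j) * G j))"
  proof (cases k)
    case 0
    have "(\<Sum>j\<in>UNIV. of_nat (\<nu> j)) = (1::complex)"
      using Suc 0 by (metis One_nat_def of_nat_1 of_nat_sum)
    then show ?thesis using 0 M by (simp add: G_def)
  next
    case (Suc l)
    define Q where "Q = (\<Prod>u=1..l. N + s - M * of_nat u)"
    have "(\<Prod>u=1..k. N + (s + M) - M * of_nat u) = (\<Prod>u=0..l. N + s - M * of_nat u)"
      unfolding Suc One_nat_def prod.atLeast_Suc_atMost_Suc_shift by (simp add: algebra_simps)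
    also have "\<dots> = (N + s) * Q"
      unfolding Q_def by (subst prod.atLeast_Suc_atMost) auto
    finally have 1: "(\<Prod>u=1..k. N + (s + M) - M * of_nat u) = (N + s) * Q" .
    have 2: "(\<Prod>u=1..k. N + s - M * of_nat u) = Q * (N + s - M * of_nat k)"
      unfolding Suc Q_def by simp
    have "(\<Sum>j\<in>UNIV. of_nat (\<nu> j) * G j) = Q * (s * of_nat (mdeg \<nu>) + N)"
    proof -
      have "G j = (s + of_nat (\<mu> j)) * Q" for j by (simp add: G_def Suc Q_def)
      then show ?thesis by (simp add: N_def sum_distrib_left sum.distrib algebra_simps)
    qed
    also have "mdeg \<nu> = Suc k" by fact
    finally have 3: "(\<Sum>j\<in>UNIV. of_nat (\<nu> j) * G j) = Q * (s * (of_nat k + 1) + N)" by (simp add: add.commute)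
    show ?thesis unfolding 1 2 3 using M by (simp add: field_simps)
  qed
  then show ?thesis using lhs rhs by (simp add: M_def)
qed

definition mdown :: "('n \<Rightarrow> nat) \<Rightarrow> ('n \<Rightarrow> nat) set" where
  "mdown \<nu> = {\<kappa>. \<forall>j. \<kappa> j \<le> \<nu> j}"

lemma finite_mdown: "finite (mdown (\<nu> :: 'n::finite \<Rightarrow> nat))"
proof -
  have "mdown \<nu> = PiE UNIV (\<lambda>j. {..\<nu> j})" by (auto simp: mdown_def PiE_def)
  then show ?thesis by (simp add: finite_PiE)
qed

definition mconv ::
  "(('n \<Rightarrow> nat) \<Rightarrow> complex) \<Rightarrow> (('n \<Rightarrow> nat) \<Rightarrow> complex) \<Rightarrow> ('n \<Rightarrow> nat) \<Rightarrow> complex" where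
  "mconv c d \<nu> = (\<Sum>\<kappa>\<in>mdown \<nu>. c \<kappa> * d (\<lambda>j. \<nu> j - \<kappa> j))"

definition is_poly_fun :: "(complex \<Rightarrow> complex) \<Rightarrow> bool" where
  "is_poly_fun f \<longleftrightarrow> (\<exists>p. f = poly p)"

lemma is_poly_fun_const: "is_poly_fun (\<lambda>s. c)"
  unfolding is_poly_fun_def by (intro exI[of _ "[:c:]"]) auto

lemma is_poly_fun_shift: "is_poly_fun (\<lambda>s. s + c)"
  unfolding is_poly_fun_def by (intro exI[of _ "[:c, 1:]"]) (auto simp: add.commute)

lemma is_poly_fun_add: "is_poly_fun f \<Longrightarrow> is_poly_fun g \<Longrightarrow> is_poly_fun (\<lambda>s. f s + g s)"
  unfolding is_poly_fun_def
proof (elim exE)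
  fix p q assume "f = poly p" "g = poly q"
  then show "\<exists>r. (\<lambda>s. f s + g s) = poly r"
    by (intro exI[of _ "p + q"]) auto
qed

lemma is_poly_fun_mult: "is_poly_fun f \<Longrightarrow> is_poly_fun g \<Longrightarrow> is_poly_fun (\<lambda>s. f s * g s)"
  unfolding is_poly_fun_def
proof (elim exE)
  fix p q assume "f = poly p" "g = poly q"
  then show "\<exists>r. (\<lambda>s. f s * g s) = poly r"
    by (intro exI[of _ "p * q"]) auto
qed

lemma is_poly_fun_diff: "is_poly_fun f \<Longrightarrow> is_poly_fun g \<Longrightarrow> is_poly_fun (\<lambda>s. f s - g s)"
  unfolding is_poly_fun_def
proof (elim exE)
  fix p q assume "f = poly p" "g = poly q"
  then show "\<exists>r. (\<lambda>s. f s - g s) = poly r"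
    by (intro exI[of _ "p - q"]) auto
qed

lemma is_poly_fun_sum: "(\<And>i. i \<in> I \<Longrightarrow> is_poly_fun (f i)) \<Longrightarrow> is_poly_fun (\<lambda>s. \<Sum>i\<in>I. f i s)"
  by (induction I rule: infinite_finite_induct) (auto intro: is_poly_fun_const is_poly_fun_add)

lemma is_poly_fun_prod: "(\<And>i. i \<in> I \<Longrightarrow> is_poly_fun (f i)) \<Longrightarrow> is_poly_fun (\<lambda>s. \<Prod>i\<in>I. f i s)"
  by (induction I rule: infinite_finite_induct) (auto intro: is_poly_fun_const is_poly_fun_mult)

lemma is_poly_fun_root_coeff: "is_poly_fun (\<lambda>s. root_coeff m \<mu> (s + t) \<nu>)"
proof -
  have "is_poly_fun (\<lambda>s. of_nat (weight \<mu> \<nu>) + (s + t) - of_nat m * of_nat u)" for u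
    by (intro is_poly_fun_diff is_poly_fun_add is_poly_fun_shift is_poly_fun_const)
  then have *: "is_poly_fun (\<lambda>s. (s + t) * (\<Prod>u=1..k. of_nat (weight \<mu> \<nu>) + (s + t) - of_nat m * of_nat u))" for k
    by (intro is_poly_fun_mult is_poly_fun_shift is_poly_fun_prod)
  show ?thesis
    unfolding root_coeff_def
  proof (rule is_poly_fun_mult[OF is_poly_fun_const])
    show "is_poly_fun (\<lambda>s. case mdeg \<nu> of 0 \<Rightarrow> 1
      | Suc k \<Rightarrow> (s + t) * (\<Prod>u=1..k. of_nat (weight \<mu> \<nu>) + (s + t) - of_nat m * of_nat u))"
      by (cases "mdeg \<nu>") (simp_all only: nat.case is_poly_fun_const *)
  qed
qed

text \<open>
  \<open>f - f 0\<close> vanishes at all multiples of \<open>c\<close>, and these are infinitely many.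
\<close>

lemma periodic_poly_fun_const:
  assumes "is_poly_fun f" "c \<noteq> 0" and per: "\<And>s. f (s + c) = f s"
  shows "f s = f 0"
proof -
  obtain p where p: "f = poly p" using assms(1) by (auto simp: is_poly_fun_def)
  define q where "q = p - [:poly p 0:]"
  have "f (of_nat n * c) = f 0" for n :: nat
  proof (induction n)
    case (Suc n)
    then show ?case using per[of "of_nat n * c"] by (simp add: algebra_simps)
  qed simp
  then have "range (\<lambda>n::nat. of_nat n * c) \<subseteq> {z. poly q z = 0}"
    by (auto simp: q_def p)
  moreover have "infinite (range (\<lambda>n::nat. of_nat n * c))"
    using assms(2) by (intro range_inj_infinite injI) auto
  ultimately have "infinite {z. poly q z = 0}" using infinite_super by blast
  then have "q = 0" using poly_roots_finite by blast
  then have "poly q s = 0" by simp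
  then show ?thesis by (simp add: q_def p)
qed

text \<open>
  The addition law \<open>Y\<^sup>s Y\<^sup>t = Y\<^bsup>s+t\<^esup>\<close>. Let \<open>C s\<close> be the defect at \<open>\<nu>\<close>. Applying the difference equation to
  both sides expresses \<open>C (s + m) - C s\<close> by defects of smaller degree, which vanish by induction. So
  \<open>C\<close> is a periodic polynomial in \<open>s\<close>, hence constant, and \<open>C 0 = 0\<close> because \<open>Y\<^sup>0 = 1\<close>.
\<close>

lemma root_coeff_mconv:
  assumes "0 < m"
  shows "mconv (root_coeff m \<mu> s) (root_coeff m \<mu> t) \<nu> = root_coeff m \<mu> (s + t) \<nu>"
proof (induction "mdeg \<nu>" arbitrary: \<nu> s rule: less_induct)
  case (less \<nu>)
  define C where "C s = root_coeff m \<mu> (s + t) \<nu> - mconv (root_coeff m \<mu> s) (root_coeff m \<mu> t) \<nu>" for s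
  define T where "T s \<kappa> j = root_coeff m \<mu> (s + of_nat (\<mu> j)) (\<kappa>(j := \<kappa> j - 1)) * root_coeff m \<mu> t (\<lambda>i. \<nu> i - \<kappa> i)" for s \<kappa> j
  \<comment> \<open>For fixed \<open>j\<close> the sum is a convolution at \<open>\<nu>\<close> lowered in the \<open>j\<close>-th entry, known by induction.\<close>
  have inner: "(\<Sum>\<kappa> | \<kappa> \<in> mdown \<nu> \<and> \<kappa> j > 0. T s \<kappa> j) =
      (if \<nu> j > 0 then root_coeff m \<mu> (s + t + of_nat (\<mu> j)) (\<nu>(j := \<nu> j - 1)) else 0)" for s j
  proof (cases "\<nu> j > 0")
    case True
    have "(\<Sum>\<kappa> | \<kappa> \<in> mdown \<nu> \<and> \<kappa> j > 0. T s \<kappa> j) =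
        mconv (root_coeff m \<mu> (s + of_nat (\<mu> j))) (root_coeff m \<mu> t) (\<nu>(j := \<nu> j - 1))"
      unfolding mconv_def
    proof (rule sum.reindex_bij_witness[of _ "\<lambda>\<kappa>. \<kappa>(j := Suc (\<kappa> j))" "\<lambda>\<kappa>. \<kappa>(j := \<kappa> j - 1)"])
      fix \<kappa> assume \<kappa>: "\<kappa> \<in> {\<kappa>. \<kappa> \<in> mdown \<nu> \<and> \<kappa> j > 0}"
      have "(\<lambda>i. (\<nu>(j := \<nu> j - 1)) i - (\<kappa>(j := \<kappa> j - 1)) i) = (\<lambda>i. \<nu> i - \<kappa> i)"
        using \<kappa> by (auto simp: fun_eq_iff mdown_def)
      then show "root_coeff m \<mu> (s + of_nat (\<mu> j)) (\<kappa>(j := \<kappa> j - 1)) *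
          root_coeff m \<mu> t (\<lambda>i. (\<nu>(j := \<nu> j - 1)) i - (\<kappa>(j := \<kappa> j - 1)) i) = T s \<kappa> j"
        by (simp only: T_def)
    next
      fix \<kappa> assume "\<kappa> \<in> {\<kappa>. \<kappa> \<in> mdown \<nu> \<and> \<kappa> j > 0}"
      then show "\<kappa>(j := \<kappa> j - 1) \<in> mdown (\<nu>(j := \<nu> j - 1))" by (auto simp: mdown_def diff_le_mono)
    next
      fix \<kappa> assume \<kappa>: "\<kappa> \<in> mdown (\<nu>(j := \<nu> j - 1))"
      have "\<kappa> i \<le> \<nu> i" if "i \<noteq> j" for i using \<kappa> that unfolding mdown_def by (metis (mono_tags) fun_upd_other mem_Collect_eq)
      moreover have "Suc (\<kappa> j) \<le> \<nu> j" using \<kappa> True unfolding mdown_def by (force dest: spec[of _ j])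
      ultimately show "\<kappa>(j := Suc (\<kappa> j)) \<in> {\<kappa>. \<kappa> \<in> mdown \<nu> \<and> \<kappa> j > 0}"
        by (simp add: mdown_def)
    qed (auto simp: fun_eq_iff)
    also have "\<dots> = root_coeff m \<mu> (s + of_nat (\<mu> j) + t) (\<nu>(j := \<nu> j - 1))"
      using mdeg_pred[of \<nu> j] True by (intro less) simp
    finally show ?thesis using True by (simp add: add_ac)
  next
    case False
    have "\<kappa> j = 0" if "\<kappa> \<in> mdown \<nu>" for \<kappa>
      using that False le_zero_eq unfolding mdown_def by (metis (mono_tags) gr0I mem_Collect_eq)
    then have empty: "{\<kappa>. \<kappa> \<in> mdown \<nu> \<and> \<kappa> j > 0} = {}" by auto
    show ?thesis using False unfolding empty by simp
  qed
  have per: "C (s + of_nat m) = C s" for s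
  proof -
    have swap: "a - x = b - y" if "x - y = a - b" for a b x y :: complex
      using that by (simp add: algebra_simps)
    have "mconv (root_coeff m \<mu> (s + of_nat m)) (root_coeff m \<mu> t) \<nu> - mconv (root_coeff m \<mu> s) (root_coeff m \<mu> t) \<nu>
       = (\<Sum>\<kappa>\<in>mdown \<nu>. (root_coeff m \<mu> (s + of_nat m) \<kappa> - root_coeff m \<mu> s \<kappa>) * root_coeff m \<mu> t (\<lambda>i. \<nu> i - \<kappa> i))"
      by (simp add: mconv_def sum_subtractf algebra_simps)
    also have "\<dots> = - (\<Sum>\<kappa>\<in>mdown \<nu>. \<Sum>j\<in>{j\<in>UNIV. \<kappa> j > 0}. T s \<kappa> j)"
      unfolding root_coeff_difference[OF assms] T_def by (simp add: sum_negf sum_distrib_right)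
    also have "\<dots> = - (\<Sum>j\<in>UNIV. \<Sum>\<kappa> | \<kappa> \<in> mdown \<nu> \<and> \<kappa> j > 0. T s \<kappa> j)"
      by (subst sum.swap_restrict) (auto simp: finite_mdown)
    also have "\<dots> = - (\<Sum>j | \<nu> j > 0. root_coeff m \<mu> (s + t + of_nat (\<mu> j)) (\<nu>(j := \<nu> j - 1)))"
      unfolding inner by (simp add: sum.If_cases)
    also have "\<dots> = root_coeff m \<mu> (s + t + of_nat m) \<nu> - root_coeff m \<mu> (s + t) \<nu>"
      by (rule root_coeff_difference[OF assms, symmetric])
    finally have "mconv (root_coeff m \<mu> (s + of_nat m)) (root_coeff m \<mu> t) \<nu> - mconv (root_coeff m \<mu> s) (root_coeff m \<mu> t) \<nu>
       = root_coeff m \<mu> (s + t + of_nat m) \<nu> - root_coeff m \<mu> (s + t) \<nu>" .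
    then have "root_coeff m \<mu> (s + t + of_nat m) \<nu> - mconv (root_coeff m \<mu> (s + of_nat m)) (root_coeff m \<mu> t) \<nu>
       = root_coeff m \<mu> (s + t) \<nu> - mconv (root_coeff m \<mu> s) (root_coeff m \<mu> t) \<nu>"
      by (rule swap)
    moreover have "s + of_nat m + t = s + t + of_nat m" by simp
    ultimately show ?thesis unfolding C_def by (simp only:)
  qed
  have "is_poly_fun C"
  proof -
    have "is_poly_fun (\<lambda>s. root_coeff m \<mu> s \<kappa>)" for \<kappa>
      using is_poly_fun_root_coeff[of m \<mu> 0 \<kappa>] by simp
    then show ?thesis
      unfolding C_def[abs_def] mconv_def
      by (intro is_poly_fun_diff is_poly_fun_root_coeff is_poly_fun_sum is_poly_fun_mult is_poly_fun_const)
  qed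
  then have "C s = C 0"
    using assms per by (intro periodic_poly_fun_const[of C "of_nat m"]) auto
  also have "C 0 = 0"
  proof -
    have "mconv (root_coeff m \<mu> 0) (root_coeff m \<mu> t) \<nu> = (\<Sum>\<kappa>\<in>{\<lambda>_. 0}. root_coeff m \<mu> t (\<lambda>i. \<nu> i - \<kappa> i))"
      unfolding mconv_def root_coeff_0
      by (rule sum.mono_neutral_cong_right) (auto simp: finite_mdown[unfolded mdown_def] mdown_def)
    then show ?thesis by (simp add: C_def)
  qed
  finally show ?case by (simp add: C_def)
qed


section \<open>Convergence and the algebraic equation\<close>

lemma power_div_fact_le_exp:
  fixes x :: real
  assumes "0 \<le> x"
  shows "x ^ k / fact k \<le> exp x"
proof -
  have "(\<lambda>n. x ^ n / fact n) sums exp x"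
    using exp_converges[of x] by (simp add: divide_inverse mult.commute)
  then have "sum (\<lambda>n. x ^ n / fact n) {k} \<le> exp x"
    using assms sum_le_suminf[of "\<lambda>n. x ^ n / fact n" "{k}"] by (auto simp: sums_iff)
  then show ?thesis by simp
qed

text \<open>
  With \<open>K = \<bar>\<nu>\<bar>\<close>, distribute \<open>K\<^sup>K\<close> over the coordinates and bound each \<open>K\<^bsup>\<nu>\<^sub>j\<^esup> / \<nu>\<^sub>j!\<close> by \<open>e\<^sup>K\<close>.
\<close>

lemma mdeg_power_div_mfact_le:
  fixes \<nu> :: "'n::finite \<Rightarrow> nat"
  shows "real (mdeg \<nu>) ^ mdeg \<nu> / (\<Prod>j\<in>UNIV. fact (\<nu> j)) \<le> exp (real CARD('n)) ^ mdeg \<nu>"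
proof -
  have "real (mdeg \<nu>) ^ mdeg \<nu> / (\<Prod>j\<in>UNIV. fact (\<nu> j)) = (\<Prod>j\<in>UNIV. real (mdeg \<nu>) ^ \<nu> j / fact (\<nu> j))"
    by (simp only: power_sum prod_dividef)
  also have "\<dots> \<le> (\<Prod>j\<in>(UNIV::'n set). exp (real (mdeg \<nu>)))"
    by (intro prod_mono conjI power_div_fact_le_exp divide_nonneg_nonneg zero_le_power of_nat_0_le_iff fact_ge_zero)
  also have "\<dots> = exp (real CARD('n)) ^ mdeg \<nu>"
    by (simp only: prod_constant exp_of_nat_mult[symmetric] mult.commute)
  finally show ?thesis .
qed

text \<open>
  With \<open>K = \<bar>\<nu>\<bar>\<close>, the bounds \<open>N \<le> m K\<close>, \<open>s \<le> m\<close> and \<open>1 \<le> u < K\<close> give \<open>\<bar>N + s - m u\<bar> \<le> m K\<close>. The powers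
  of \<open>m\<close> cancel and leave at most \<open>K\<^sup>K / \<nu>!\<close>.
\<close>

lemma norm_root_coeff_le:
  fixes \<nu> :: "'n::finite \<Rightarrow> nat"
  assumes m: "0 < m" and \<mu>: "\<And>j. \<mu> j \<le> m" and s: "s \<le> m"
  shows "norm (root_coeff m \<mu> (of_nat s) \<nu>) \<le> exp (real CARD('n)) ^ mdeg \<nu>"
proof (cases "mdeg \<nu>")
  case 0
  then show ?thesis by (simp add: root_coeff_def)
next
  case (Suc k)
  have N: "weight \<mu> \<nu> \<le> m * Suc k"
    unfolding Suc[symmetric] sum_distrib_left by (intro sum_mono mult_right_mono \<mu>) auto
  have factor: "norm (of_nat (weight \<mu> \<nu>) + of_nat s - of_nat m * of_nat u :: complex) \<le> real (m * Suc k)"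
    if "u \<in> {1..k}" for u
  proof -
    have u: "m * u \<le> m * k" "m \<le> m * u" using that m by auto
    have "norm (of_nat (weight \<mu> \<nu>) + of_nat s - of_nat m * of_nat u :: complex)
        = norm (of_int (int (weight \<mu> \<nu> + s) - int (m * u)) :: complex)" by simp
    also have "\<dots> = real_of_int \<bar>int (weight \<mu> \<nu> + s) - int (m * u)\<bar>"
      by (simp only: norm_of_int)
    also have "\<dots> \<le> real_of_int (int (m * Suc k))"
      unfolding of_int_le_iff using N s u by (simp only: mult_Suc_right)
    finally show ?thesis by simp
  qed
  have "norm (\<Prod>u=1..k. of_nat (weight \<mu> \<nu>) + of_nat s - of_nat m * of_nat u :: complex) \<le> (\<Prod>u=1..k. real (m * Suc k))"
    unfolding prod_norm[symmetric] by (intro prod_mono conjI norm_ge_zero factor)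
  also have "\<dots> = real (m * Suc k) ^ k" by (simp only: prod_constant card_atLeastAtMost diff_Suc_1)
  finally have P: "norm (\<Prod>u=1..k. of_nat (weight \<mu> \<nu>) + of_nat s - of_nat m * of_nat u :: complex) \<le> real (m * Suc k) ^ k" .
  define F where "F = (\<Prod>j\<in>UNIV. fact (\<nu> j) :: real)"
  have F: "F > 0" unfolding F_def by (intro prod_pos) auto
  have nF: "norm (mfact \<nu>) = F" by (simp add: F_def prod_norm[symmetric])
  have "norm (root_coeff m \<mu> (of_nat s) \<nu>) = 1 / real m ^ Suc k / F * (real s *
      norm (\<Prod>u=1..k. of_nat (weight \<mu> \<nu>) + of_nat s - of_nat m * of_nat u :: complex))"
    unfolding root_coeff_def Suc nat.case norm_mult norm_divide nF norm_power by (simp add: power_one_over)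
  also have "\<dots> \<le> 1 / real m ^ Suc k / F * (real m * real (m * Suc k) ^ k)"
    by (rule mult_left_mono[OF mult_mono[OF _ P]]) (use F s in auto)
  also have "\<dots> = real (Suc k) ^ k / F"
    unfolding of_nat_mult power_mult_distrib using m F by (simp add: field_simps del: of_nat_Suc)
  also have "\<dots> \<le> real (Suc k) ^ Suc k / F"
    using F by (auto intro!: divide_right_mono power_increasing)
  also have "\<dots> \<le> exp (real CARD('n)) ^ mdeg \<nu>"
    using mdeg_power_div_mfact_le[of \<nu>] unfolding F_def Suc .
  finally show ?thesis .
qed

text \<open>
  Finite sets of multi-indices lie in boxes, over which the sum is a product of geometric sums.
\<close>

lemma summable_on_power_mdeg:
  fixes q :: real
  assumes "0 \<le> q" "q < 1"
  shows "(\<lambda>\<nu>. q ^ mdeg \<nu>) summable_on (UNIV :: ('n::finite \<Rightarrow> nat) set)"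
proof (rule nonneg_bdd_above_summable_on)
  show "bdd_above (sum (\<lambda>\<nu>. q ^ mdeg \<nu>) ` {F. F \<subseteq> (UNIV :: ('n \<Rightarrow> nat) set) \<and> finite F})"
  proof (rule bdd_aboveI2)
    fix F :: "('n \<Rightarrow> nat) set" assume "F \<in> {F. F \<subseteq> UNIV \<and> finite F}"
    then have F: "finite F" by simp
    define M where "M = Max (insert 0 ((\<lambda>(\<nu>, j). \<nu> j) ` (F \<times> UNIV)))"
    have M: "\<nu> j \<le> M" if "\<nu> \<in> F" for \<nu> j
      unfolding M_def using F that by (intro Max_ge) force+
    have "sum (\<lambda>\<nu>. q ^ mdeg \<nu>) F \<le> sum (\<lambda>\<nu>. q ^ mdeg \<nu>) (PiE (UNIV :: 'n set) (\<lambda>_. {..M}))"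
      by (rule sum_mono2) (use M assms in \<open>auto intro!: finite_PiE\<close>)
    also have "\<dots> = (\<Prod>j\<in>(UNIV :: 'n set). \<Sum>k\<le>M. q ^ k)"
      unfolding power_sum by (subst prod_sum_PiE) auto
    also have "\<dots> \<le> (\<Prod>j\<in>(UNIV :: 'n set). 1 / (1 - q))"
    proof (intro prod_mono conjI sum_nonneg)
      have "(\<Sum>k\<le>M. q ^ k) \<le> (\<Sum>k. q ^ k)"
        using assms by (intro sum_le_suminf summable_geometric) auto
      then show "(\<Sum>k\<le>M. q ^ k) \<le> 1 / (1 - q)"
        using assms by (simp add: suminf_geometric)
    qed (use assms in auto)
    finally show "sum (\<lambda>\<nu>. q ^ mdeg \<nu>) F \<le> (\<Prod>j\<in>(UNIV :: 'n set). 1 / (1 - q))" .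
  qed
qed (use assms in auto)

lemma geometric_bound_imp_has_pseries:
  fixes c :: "('n::finite \<Rightarrow> nat) \<Rightarrow> complex"
  assumes R: "0 < R" and bound: "\<And>\<nu>. norm (c \<nu>) \<le> R ^ mdeg \<nu>"
  shows "has_pseries c (\<lambda>x. \<Sum>\<^sub>\<infinity>\<nu>. c \<nu> * monomial \<nu> x) (1 / R)"
  unfolding has_pseries_def
proof
  fix x :: "complex ^ 'n" assume "x \<in> polydisc (1 / R)"
  then obtain \<sigma> where \<sigma>: "0 < \<sigma>" "\<sigma> < 1 / R" "\<And>j. norm (x $ j) < \<sigma>"
    by (rule polydisc_radius) blast
  have "(\<lambda>\<nu>. norm (c \<nu> * monomial \<nu> x)) summable_on UNIV"
  proof (rule summable_on_comparison_test)
    show "(\<lambda>\<nu>::'n \<Rightarrow> nat. (R * \<sigma>) ^ mdeg \<nu>) summable_on UNIV"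
      using \<sigma> R by (intro summable_on_power_mdeg) (auto simp: pos_less_divide_eq mult.commute)
    show "norm (c \<nu> * monomial \<nu> x) \<le> (R * \<sigma>) ^ mdeg \<nu>" for \<nu>
    proof -
      have "norm (monomial \<nu> x) \<le> \<sigma> ^ mdeg \<nu>"
        using \<sigma>(3) by (intro norm_monomial_le less_imp_le)
      then show ?thesis
        unfolding norm_mult power_mult_distrib using R by (intro mult_mono bound) auto
    qed
  qed auto
  then show "((\<lambda>\<nu>. c \<nu> * monomial \<nu> x) has_sum (\<Sum>\<^sub>\<infinity>\<nu>. c \<nu> * monomial \<nu> x)) UNIV"
    by (rule has_sum_infsum[OF abs_summable_summable])
qed

lemma monomial_mult: "monomial \<nu> x * monomial \<kappa> x = monomial (\<lambda>j. \<nu> j + \<kappa> j) x"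
  by (simp add: monomial_def power_add prod.distrib)

text \<open>
  The Cauchy product: \<open>(\<kappa>, \<eta>) \<mapsto> (\<kappa> + \<eta>, \<kappa>)\<close> turns the absolutely convergent double series into one
  with finite rows.
\<close>

lemma has_pseries_mult:
  fixes c d :: "('n::finite \<Rightarrow> nat) \<Rightarrow> complex"
  assumes "has_pseries c f \<rho>" "has_pseries d g \<rho>"
  shows "has_pseries (mconv c d) (\<lambda>x. f x * g x) \<rho>"
  unfolding has_pseries_def
proof
  fix x :: "complex ^ 'n" assume "x \<in> polydisc \<rho>"
  then have f: "((\<lambda>\<nu>. c \<nu> * monomial \<nu> x) has_sum f x) UNIV"
    and g: "((\<lambda>\<nu>. d \<nu> * monomial \<nu> x) has_sum g x) UNIV"
    using assms by (auto simp: has_pseries_def)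
  define T where "T = (\<lambda>(\<kappa>, \<eta>). (c \<kappa> * monomial \<kappa> x) * (d \<eta> * monomial \<eta> x))"
  have "(T has_sum (f x * g x)) (UNIV \<times> UNIV)"
  proof (rule has_sum_SigmaI)
    show "((\<lambda>\<eta>. T (\<kappa>, \<eta>)) has_sum (c \<kappa> * monomial \<kappa> x) * g x) UNIV" for \<kappa>
      unfolding T_def prod.case by (intro has_sum_cmult_right g)
    show "((\<lambda>\<kappa>. (c \<kappa> * monomial \<kappa> x) * g x) has_sum f x * g x) UNIV"
      by (intro has_sum_cmult_left f)
    show "T summable_on UNIV \<times> UNIV"
    proof (rule abs_summable_summable, rule summable_on_SigmaI)
      have nf: "(\<lambda>\<nu>. norm (c \<nu> * monomial \<nu> x)) summable_on UNIV"
        and ng: "(\<lambda>\<nu>. norm (d \<nu> * monomial \<nu> x)) summable_on UNIV"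
        using has_sum_imp_summable[OF f] has_sum_imp_summable[OF g]
        by (simp_all only: summable_on_iff_abs_summable_on_complex[symmetric])
      show "((\<lambda>\<eta>. norm (T (\<kappa>, \<eta>))) has_sum
          norm (c \<kappa> * monomial \<kappa> x) * (\<Sum>\<^sub>\<infinity>\<nu>. norm (d \<nu> * monomial \<nu> x))) UNIV" for \<kappa>
        unfolding T_def prod.case norm_mult[of "c \<kappa> * monomial \<kappa> x"]
        by (intro has_sum_cmult_right has_sum_infsum ng)
      show "(\<lambda>\<kappa>. norm (c \<kappa> * monomial \<kappa> x) * (\<Sum>\<^sub>\<infinity>\<nu>. norm (d \<nu> * monomial \<nu> x))) summable_on UNIV"
        by (intro summable_on_cmult_left nf)
    qed auto
  qed
  also have "(T has_sum (f x * g x)) (UNIV \<times> UNIV) \<longleftrightarrow>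
      ((\<lambda>(\<nu>, \<kappa>). T (\<kappa>, \<lambda>j. \<nu> j - \<kappa> j)) has_sum (f x * g x)) (Sigma UNIV mdown)"
    by (rule has_sum_reindex_bij_witness[where j = "\<lambda>(\<kappa>, \<eta>). (\<lambda>j. \<kappa> j + \<eta> j, \<kappa>)"
          and i = "\<lambda>(\<nu>, \<kappa>). (\<kappa>, \<lambda>j. \<nu> j - \<kappa> j)"])
      (auto simp: mdown_def fun_eq_iff)
  finally show "((\<lambda>\<nu>. mconv c d \<nu> * monomial \<nu> x) has_sum f x * g x) UNIV"
  proof (rule has_sum_SigmaD)
    fix \<nu> :: "'n \<Rightarrow> nat"
    have eq: "(c \<kappa> * monomial \<kappa> x) * (d (\<lambda>j. \<nu> j - \<kappa> j) * monomial (\<lambda>j. \<nu> j - \<kappa> j) x) =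
        c \<kappa> * d (\<lambda>j. \<nu> j - \<kappa> j) * monomial \<nu> x" if "\<kappa> \<in> mdown \<nu>" for \<kappa>
    proof -
      have "(\<lambda>j. \<kappa> j + (\<nu> j - \<kappa> j)) = \<nu>" using that by (auto simp: mdown_def)
      then show ?thesis using monomial_mult[of \<kappa> x "\<lambda>j. \<nu> j - \<kappa> j"] by (simp add: mult_ac)
    qed
    show "((\<lambda>\<kappa>. case (\<nu>, \<kappa>) of (\<nu>, \<kappa>) \<Rightarrow> T (\<kappa>, \<lambda>j. \<nu> j - \<kappa> j)) has_sum mconv c d \<nu> * monomial \<nu> x) (mdown \<nu>)"
      unfolding T_def prod.case mconv_def sum_distrib_right
      by (rule has_sum_finiteI[OF finite_mdown sum.cong[OF refl eq[symmetric]]])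
  qed
qed

lemma has_pseries_coord_mult:
  fixes c :: "('n::finite \<Rightarrow> nat) \<Rightarrow> complex"
  assumes "has_pseries c f \<rho>"
  shows "has_pseries (\<lambda>\<nu>. if \<nu> j > 0 then c (\<nu>(j := \<nu> j - 1)) else 0) (\<lambda>x. x $ j * f x) \<rho>"
  unfolding has_pseries_def
proof
  fix x :: "complex ^ 'n" assume "x \<in> polydisc \<rho>"
  then have "((\<lambda>\<nu>. c \<nu> * monomial \<nu> x) has_sum f x) UNIV"
    using assms by (simp add: has_pseries_def)
  then have "((\<lambda>\<nu>. x $ j * (c \<nu> * monomial \<nu> x)) has_sum x $ j * f x) UNIV"
    by (rule has_sum_cmult_right)
  then show "((\<lambda>\<nu>. (if \<nu> j > 0 then c (\<nu>(j := \<nu> j - 1)) else 0) * monomial \<nu> x) has_sum x $ j * f x) UNIV"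
    by (subst has_sum_shift[of j]) (auto simp: monomial_Suc mult_ac)
qed

text \<open>The reciprocal of the growth rate in the geometric bound for the coefficients.\<close>

definition root_radius :: "'n::finite itself \<Rightarrow> real" where
  "root_radius _ = 1 / exp (real CARD('n))"

definition root_series :: "nat \<Rightarrow> ('n::finite \<Rightarrow> nat) \<Rightarrow> nat \<Rightarrow> complex ^ 'n \<Rightarrow> complex" where
  "root_series m \<mu> s x = (\<Sum>\<^sub>\<infinity>\<nu>. root_coeff m \<mu> (of_nat s) \<nu> * monomial \<nu> x)"

lemma has_pseries_root_series:
  fixes \<mu> :: "'n::finite \<Rightarrow> nat"
  assumes "0 < m" "\<And>j. \<mu> j \<le> m" "s \<le> m"
  shows "has_pseries (root_coeff m \<mu> (of_nat s)) (root_series m \<mu> s) (root_radius TYPE('n))"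
  unfolding root_series_def[abs_def] root_radius_def
  by (intro geometric_bound_imp_has_pseries norm_root_coeff_le assms) auto

lemma has_pseries_fun_unique:
  "has_pseries c f \<rho> \<Longrightarrow> has_pseries c g \<rho> \<Longrightarrow> x \<in> polydisc \<rho> \<Longrightarrow> f x = g x"
  unfolding has_pseries_def using has_sum_unique by blast

text \<open>The addition law for coefficients becomes multiplicativity of the sums.\<close>

lemma root_series_power:
  fixes \<mu> :: "'n::finite \<Rightarrow> nat"
  assumes m: "0 < m" and \<mu>: "\<And>j. \<mu> j \<le> m" and "s \<le> m" and x: "x \<in> polydisc (root_radius TYPE('n))"
  shows "root_series m \<mu> s x = root_series m \<mu> 1 x ^ s"
  using \<open>s \<le> m\<close>
proof (induction s)
  case 0
  have "((\<lambda>\<nu>. root_coeff m \<mu> 0 \<nu> * monomial \<nu> x) has_sum 1) UNIV"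
    by (rule has_sum_finite_neutralI[of "{\<lambda>_. 0}"]) (auto simp: root_coeff_0 monomial_def)
  then show ?case by (simp add: root_series_def infsumI)
next
  case (Suc s)
  let ?\<rho> = "root_radius TYPE('n)"
  have s: "s \<le> m" "1 \<le> m" using Suc.prems m by auto
  have conv: "mconv (root_coeff m \<mu> (of_nat s)) (root_coeff m \<mu> (of_nat 1)) = root_coeff m \<mu> (of_nat (Suc s))"
  proof
    fix \<nu>
    have "of_nat s + of_nat 1 = (of_nat (Suc s) :: complex)" by simp
    then show "mconv (root_coeff m \<mu> (of_nat s)) (root_coeff m \<mu> (of_nat 1)) \<nu> = root_coeff m \<mu> (of_nat (Suc s)) \<nu>"
      by (simp only: root_coeff_mconv[OF m])
  qed
  have "has_pseries (mconv (root_coeff m \<mu> (of_nat s)) (root_coeff m \<mu> (of_nat 1)))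
      (\<lambda>x. root_series m \<mu> s x * root_series m \<mu> 1 x) ?\<rho>"
    by (intro has_pseries_mult has_pseries_root_series m \<mu> s)
  then have "has_pseries (root_coeff m \<mu> (of_nat (Suc s))) (\<lambda>x. root_series m \<mu> s x * root_series m \<mu> 1 x) ?\<rho>"
    by (simp only: conv)
  from has_pseries_fun_unique[OF has_pseries_root_series[OF m \<mu> Suc.prems] this x]
  have "root_series m \<mu> (Suc s) x = root_series m \<mu> s x * root_series m \<mu> 1 x" .
  also have "root_series m \<mu> s x = root_series m \<mu> 1 x ^ s" by (rule Suc.IH[OF s(1)])
  finally show ?case by (simp only: power_Suc2)
qed

text \<open>
  The case \<open>s = 0\<close> of the difference equation, summed up: the exponents \<open>m\<close> and \<open>\<mu>\<^sub>j\<close> are those of the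
  equation, and they are within the range \<open>s \<le> m\<close> in which the coefficients are bounded.
\<close>

theorem root_series_equation:
  fixes \<mu> :: "'n::finite \<Rightarrow> nat"
  assumes m: "0 < m" and \<mu>: "\<And>j. \<mu> j \<le> m" and x: "x \<in> polydisc (root_radius TYPE('n))"
  shows "root_series m \<mu> 1 x ^ m + (\<Sum>j\<in>UNIV. x $ j * root_series m \<mu> 1 x ^ \<mu> j) - 1 = 0"
proof -
  let ?\<rho> = "root_radius TYPE('n)"
  have "has_pseries (\<lambda>\<nu>. root_coeff m \<mu> (of_nat m) \<nu> +
        (\<Sum>j\<in>UNIV. if \<nu> j > 0 then root_coeff m \<mu> (of_nat (\<mu> j)) (\<nu>(j := \<nu> j - 1)) else 0))
      (\<lambda>x. root_series m \<mu> m x + (\<Sum>j\<in>UNIV. x $ j * root_series m \<mu> (\<mu> j) x)) ?\<rho>"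
    by (intro has_pseries_add has_pseries_sum has_pseries_coord_mult has_pseries_root_series m \<mu> order_refl)
  moreover have "root_coeff m \<mu> (of_nat m) \<nu> +
      (\<Sum>j\<in>UNIV. if \<nu> j > 0 then root_coeff m \<mu> (of_nat (\<mu> j)) (\<nu>(j := \<nu> j - 1)) else 0) = root_coeff m \<mu> (of_nat 0) \<nu>" for \<nu>
    using root_coeff_difference[OF m, of \<mu> 0 \<nu>] by (simp add: sum.If_cases algebra_simps)
  ultimately have "has_pseries (root_coeff m \<mu> (of_nat 0))
      (\<lambda>x. root_series m \<mu> m x + (\<Sum>j\<in>UNIV. x $ j * root_series m \<mu> (\<mu> j) x)) ?\<rho>" by simp
  from has_pseries_fun_unique[OF this has_pseries_root_series[OF m \<mu> le0] x]
  have "root_series m \<mu> m x + (\<Sum>j\<in>UNIV. x $ j * root_series m \<mu> (\<mu> j) x) = root_series m \<mu> 0 x" .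
  then have "root_series m \<mu> 1 x ^ m + (\<Sum>j\<in>UNIV. x $ j * root_series m \<mu> 1 x ^ \<mu> j) = root_series m \<mu> 1 x ^ 0"
    by (simp only: root_series_power[OF m \<mu> order_refl x] root_series_power[OF m \<mu> \<mu> x] root_series_power[OF m \<mu> le0 x])
  then show ?thesis by simp
qed


section \<open>The recurrence for the principal solution\<close>

lemma prod_lessThan_add:
  fixes f :: "nat \<Rightarrow> 'a::comm_monoid_mult"
  shows "(\<Prod>u<a + b. f u) = (\<Prod>u<a. f u) * (\<Prod>v<b. f (a + v))"
  by (induction b) (simp_all add: mult.assoc)

lemma fact_add_pochhammer: "fact (n + k) = fact n * pochhammer (of_nat n + 1 :: complex) k"
  by (induction k) (simp_all add: pochhammer_Suc algebra_simps)

lemma of_nat_plus_1_neq_0: "of_nat n + 1 \<noteq> (0 :: complex)"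
  using of_nat_neq_0[of n, where 'a = complex] by (simp add: add.commute)

text \<open>
  Multiplying by \<open>N + 1\<close> supplies the factor \<open>u = 0\<close>, after which degree \<open>0\<close> is no exception. As
  \<open>N + 1\<close> is never \<open>0\<close>, nothing is lost.
\<close>

lemma root_coeff_1_product:
  "root_coeff m \<mu> 1 \<nu> * (of_nat (weight \<mu> \<nu>) + 1) * mfact \<nu> =
     (- 1 / of_nat m) ^ mdeg \<nu> * (\<Prod>u<mdeg \<nu>. of_nat (weight \<mu> \<nu>) + 1 - of_nat m * of_nat u)"
proof (cases "mdeg \<nu>")
  case 0
  then have "\<nu> = (\<lambda>_. 0)" by (simp only: mdeg_eq_0_iff)
  then show ?thesis by (simp add: root_coeff_def)
next
  case (Suc k)
  define X :: complex where "X = of_nat (weight \<mu> \<nu>) + 1"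
  have "(\<Prod>u<Suc k. X - of_nat m * of_nat u) = X * (\<Prod>u=1..k. X - of_nat m * of_nat u)"
    unfolding prod.lessThan_Suc_shift by (simp add: prod.atLeast1_atMost_eq)
  then show ?thesis
    unfolding root_coeff_def Suc nat.case X_def[symmetric] by (simp add: mfact_nonzero)
qed

lemma mellin_factor_second:
  assumes "\<And>i. \<mu> i \<le> m"
  shows "of_nat (\<Sum>i\<in>UNIV. (m - \<mu> i) * \<nu> i) = (of_nat m * of_nat (mdeg \<nu>) - of_nat (weight \<mu> \<nu>) :: complex)"
proof -
  have "(\<Sum>i\<in>UNIV. (m - \<mu> i) * \<nu> i) + weight \<mu> \<nu> = m * mdeg \<nu>"
    using assms by (simp add: sum.distrib[symmetric] distrib_right[symmetric] sum_distrib_left)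
  then have "of_nat ((\<Sum>i\<in>UNIV. (m - \<mu> i) * \<nu> i) + weight \<mu> \<nu>) = (of_nat (m * mdeg \<nu>) :: complex)"
    by (rule arg_cong)
  then show ?thesis by (simp only: of_nat_add of_nat_mult eq_diff_eq)
qed

text \<open>
  Write \<open>\<nu>'\<close> for \<open>\<nu>\<close> with \<open>m\<close> added to the \<open>j\<close>-th entry. Then \<open>N\<close> grows by \<open>m \<mu>\<^sub>j\<close> and the degree \<open>K\<close> by
  \<open>m\<close>. The product for \<open>\<nu>'\<close> splits into three ranges of \<open>u\<close>: the first \<open>\<mu>\<^sub>j\<close> factors are the first
  product of the Mellin operator, with the argument moved by one step; the next \<open>K\<close> factors are the
  product for \<open>\<nu>\<close>; the last \<open>m - \<mu>\<^sub>j\<close> factors are the second product up to sign.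
\<close>

lemma mellin_recurrence_root_coeff:
  fixes \<mu> :: "'n::finite \<Rightarrow> nat"
  assumes m: "0 < m" and \<mu>: "\<And>j. \<mu> j \<le> m"
  shows "mellin_recurrence m \<mu> (root_coeff m \<mu> 1)"
  unfolding mellin_recurrence_def
proof (intro allI)
  fix j and \<nu> :: "'n \<Rightarrow> nat"
  define \<nu>' where "\<nu>' = \<nu>(j := \<nu> j + m)"
  define N :: complex where "N = of_nat (weight \<mu> \<nu>)"
  define M :: complex where "M = of_nat m"
  define K where "K = mdeg \<nu>"
  define a where "a = \<mu> j"
  define b where "b = m - \<mu> j"
  have M: "M \<noteq> 0" using m by (simp add: M_def)
  have ab: "m = a + b" using \<mu>[of j] by (simp add: a_def b_def)
  have K': "mdeg \<nu>' = a + (K + b)"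
    unfolding K_def \<nu>'_def by (simp add: sum.remove[of UNIV j] ab)
  have "weight \<mu> \<nu>' = weight \<mu> \<nu> + m * a"
    unfolding \<nu>'_def a_def by (simp add: sum.remove[of UNIV j] algebra_simps)
  then have N': "of_nat (weight \<mu> \<nu>') = N + M * of_nat a"
    unfolding N_def M_def by (simp only: of_nat_add of_nat_mult)
  have F': "mfact \<nu>' = mfact \<nu> * pochhammer (of_nat (\<nu> j) + 1) m"
    unfolding \<nu>'_def by (simp add: prod.remove[of UNIV j] fact_add_pochhammer)
  define A where "A = (\<Prod>k<a. N + 1 + M * of_nat k)"
  define B where "B = (\<Prod>k<b. M * of_nat K - N + (M * of_nat k - 1))"
  define P where "P = (\<Prod>u<K. N + 1 - M * of_nat u)"
  have factor: "mellin_factor m \<mu> j \<nu> = A * B"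
    unfolding mellin_factor_def mellin_factor_second[OF \<mu>] A_def B_def a_def b_def N_def M_def K_def
    by (simp add: add_ac)
  have split: "(\<Prod>u<a + (K + b). N + M * of_nat a + 1 - M * of_nat u) =
      (\<Prod>u<a. N + M * of_nat a + 1 - M * of_nat u) * (P * (\<Prod>k<b. N + 1 - M * of_nat (K + k)))"
    unfolding prod_lessThan_add P_def by (simp add: algebra_simps)
  \<comment> \<open>Both sides are the product of \<open>N + 1 + m k\<close> over \<open>0 \<le> k \<le> a\<close>.\<close>
  have part1: "(N + 1) * (\<Prod>u<a. N + M * of_nat a + 1 - M * of_nat u) = A * (N + M * of_nat a + 1)"
  proof -
    have "(\<Prod>u<a. N + M * of_nat a + 1 - M * of_nat u) = (\<Prod>u<a. N + 1 + M * of_nat (Suc (a - Suc u)))"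
    proof (rule prod.cong[OF refl])
      fix u assume "u \<in> {..<a}"
      then have "Suc (a - Suc u) = a - u" "u \<le> a" by auto
      then show "N + M * of_nat a + 1 - M * of_nat u = N + 1 + M * of_nat (Suc (a - Suc u))"
        by (simp only: of_nat_diff) (simp add: algebra_simps)
    qed
    also have "\<dots> = (\<Prod>k<a. N + 1 + M * of_nat (Suc k))"
      by (rule prod.nat_diff_reindex)
    finally have "(N + 1) * (\<Prod>u<a. N + M * of_nat a + 1 - M * of_nat u) = (\<Prod>k<Suc a. N + 1 + M * of_nat k)"
      unfolding prod.lessThan_Suc_shift by simp
    then show ?thesis unfolding A_def by (simp add: add_ac)
  qed
  have part2: "(\<Prod>k<b. N + 1 - M * of_nat (K + k)) = (- 1) ^ b * B"
  proof -
    have "(\<Prod>k<b. N + 1 - M * of_nat (K + k)) = (\<Prod>k<b. (- 1) * (M * of_nat K - N + (M * of_nat k - 1)))"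
      by (rule prod.cong[OF refl]) (simp add: algebra_simps)
    then show ?thesis unfolding B_def prod.distrib by simp
  qed
  define p where "p = root_coeff m \<mu> 1 \<nu>"
  define p' where "p' = root_coeff m \<mu> 1 \<nu>'"
  define D where "D = pochhammer (of_nat (\<nu> j) + 1 :: complex) m"
  define F where "F = mfact \<nu>"
  define E where "E = (- 1 / M) ^ K"
  have N1: "N + 1 \<noteq> 0" unfolding N_def by (rule of_nat_plus_1_neq_0)
  have N1': "N + M * of_nat a + 1 \<noteq> 0" unfolding N'[symmetric] by (rule of_nat_plus_1_neq_0)
  have F: "F \<noteq> 0" by (simp add: F_def)
  have p: "p * (N + 1) * F = E * P"
    using root_coeff_1_product[of m \<mu> \<nu>] unfolding p_def F_def E_def P_def N_def M_def K_def .
  have "p' * (N + M * of_nat a + 1) * (F * D) = (- 1 / M) ^ (a + (K + b)) *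
      ((\<Prod>u<a. N + M * of_nat a + 1 - M * of_nat u) * (P * ((- 1) ^ b * B)))"
    using root_coeff_1_product[of m \<mu> \<nu>'] unfolding K' N' F' M_def[symmetric] split part2
    unfolding p'_def F_def D_def .
  then have "(N + 1) * (p' * (N + M * of_nat a + 1) * (F * D)) = (- 1 / M) ^ (a + (K + b)) *
      (((N + 1) * (\<Prod>u<a. N + M * of_nat a + 1 - M * of_nat u)) * (P * ((- 1) ^ b * B)))"
    by (simp only: mult_ac)
  also have "\<dots> = (- 1 / M) ^ m * (- 1) ^ b * A * B * (N + M * of_nat a + 1) * (E * P)"
    unfolding part1 E_def ab power_add by (simp only: mult_ac)
  also have "\<dots> = (N + 1) * (N + M * of_nat a + 1) * F * ((- 1 / M) ^ m * (- 1) ^ b * A * B * p)"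
    unfolding p[symmetric] by (simp only: mult_ac)
  finally have "(N + 1) * (N + M * of_nat a + 1) * F * (p' * D) =
      (N + 1) * (N + M * of_nat a + 1) * F * ((- 1 / M) ^ m * (- 1) ^ b * A * B * p)"
    by (simp only: mult_ac)
  then have eq: "p' * D = (- 1 / M) ^ m * (- 1) ^ b * A * B * p"
    using N1 N1' F by (simp only: mult_cancel_left) simp
  have "(- 1) ^ a * M ^ m * (D * p') = ((- 1) ^ a * (- 1) ^ b * (M ^ m * (- 1 / M) ^ m)) * (A * B * p)"
    unfolding mult.commute[of D p'] eq by (simp only: mult_ac)
  also have "M ^ m * (- 1 / M) ^ m = (- 1) ^ m"
    unfolding power_mult_distrib[symmetric] using M by simp
  also have "(- 1) ^ a * (- 1) ^ b * (- 1) ^ m = (1 :: complex)"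
    unfolding power_add[symmetric] ab by simp
  finally show "mellin_factor m \<mu> j \<nu> * root_coeff m \<mu> 1 \<nu> = (- 1) ^ \<mu> j * of_nat m ^ m *
      (pochhammer (of_nat (\<nu> j) + 1) m * root_coeff m \<mu> 1 (\<nu>(j := \<nu> j + m)))"
    unfolding factor by (simp only: a_def M_def D_def p_def p'_def \<nu>'_def mult_1)
qed

text \<open>
  The factors \<open>N + 1 - m u\<close> are integers congruent to \<open>1\<close> modulo the common divisor \<open>d\<close>. This is
  where \<open>d > 1\<close> enters.
\<close>

lemma root_coeff_1_nonzero:
  fixes \<mu> :: "'n::finite \<Rightarrow> nat"
  assumes d: "1 < d" "d dvd m" "\<And>j. d dvd \<mu> j" and m: "0 < m"
  shows "root_coeff m \<mu> 1 \<nu> \<noteq> 0"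
proof
  assume "root_coeff m \<mu> 1 \<nu> = 0"
  then have "(\<Prod>u<mdeg \<nu>. of_nat (weight \<mu> \<nu>) + 1 - of_nat m * of_nat u) = (0 :: complex)"
    using root_coeff_1_product[of m \<mu> \<nu>] m by (simp del: of_nat_sum sum_eq_0_iff prod_zero_iff)
  then obtain u where "of_nat (weight \<mu> \<nu>) + 1 - of_nat m * of_nat u = (0 :: complex)"
    by (auto simp del: of_nat_sum simp: prod_zero_iff)
  then have "of_nat (weight \<mu> \<nu> + 1) = (of_nat (m * u) :: complex)" by (simp add: algebra_simps del: of_nat_sum)
  then have "weight \<mu> \<nu> + 1 = m * u" by (rule of_nat_eq_iff[THEN iffD1])
  moreover have "d dvd weight \<mu> \<nu>" using d(3) by (intro dvd_sum) auto
  moreover have "d dvd m * u" using d(2) by simp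
  ultimately have "d dvd 1" by (metis dvd_add_right_iff)
  then show False using d(1) by simp
qed

lemma pochhammer_of_nat_nonzero: "pochhammer (of_nat n + 1 :: complex) k \<noteq> 0"
proof
  assume "pochhammer (of_nat n + 1 :: complex) k = 0"
  then have "fact (n + k) = (0 :: complex)" by (simp only: fact_add_pochhammer mult_zero_right)
  then show False by simp
qed

text \<open>
  Both sequences are multiplied by the same number \<open>A / L\<close> when \<open>m\<close> is added to the \<open>j\<close>-th entry, and
  that number is nonzero because \<open>p\<close> has no zeros.
\<close>

lemma mellin_recurrence_ratio_periodic:
  assumes c: "mellin_recurrence m \<mu> c" and p: "mellin_recurrence m \<mu> p" and nz: "\<And>\<nu>. p \<nu> \<noteq> 0" and m: "0 < m"
  shows "c (\<nu>(j := \<nu> j + m)) / p (\<nu>(j := \<nu> j + m)) = c \<nu> / p \<nu>"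
proof -
  define L where "L = (-1) ^ \<mu> j * of_nat m ^ m * pochhammer (of_nat (\<nu> j) + 1 :: complex) m"
  define A where "A = mellin_factor m \<mu> j \<nu>"
  have L: "L \<noteq> 0" using m pochhammer_of_nat_nonzero by (simp add: L_def)
  have "A * c \<nu> = L * c (\<nu>(j := \<nu> j + m))" "A * p \<nu> = L * p (\<nu>(j := \<nu> j + m))"
    using c p unfolding mellin_recurrence_def A_def L_def by (simp_all only: mult.assoc)
  then have "c (\<nu>(j := \<nu> j + m)) = A * c \<nu> / L" "p (\<nu>(j := \<nu> j + m)) = A * p \<nu> / L"
    using L by (simp_all add: field_simps)
  moreover from this have "A \<noteq> 0" using nz[of "\<nu>(j := \<nu> j + m)"] by auto
  ultimately show ?thesis using L by simp
qed

lemma mellin_recurrence_periodic_mult: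
  assumes p: "mellin_recurrence m \<mu> p" and e: "\<And>\<nu> j. e (\<nu>(j := \<nu> j + m)) = e \<nu>"
  shows "mellin_recurrence m \<mu> (\<lambda>\<nu>. e \<nu> * p \<nu>)"
  unfolding mellin_recurrence_def e
proof (intro allI)
  fix j \<nu>
  have "mellin_factor m \<mu> j \<nu> * (e \<nu> * p \<nu>) = e \<nu> * (mellin_factor m \<mu> j \<nu> * p \<nu>)"
    by (simp only: mult_ac)
  also have "mellin_factor m \<mu> j \<nu> * p \<nu> = (-1) ^ \<mu> j * of_nat m ^ m * (pochhammer (of_nat (\<nu> j) + 1) m * p (\<nu>(j := \<nu> j + m)))"
    using p unfolding mellin_recurrence_def by blast
  finally show "mellin_factor m \<mu> j \<nu> * (e \<nu> * p \<nu>) =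
      (-1) ^ \<mu> j * of_nat m ^ m * (pochhammer (of_nat (\<nu> j) + 1) m * (e \<nu> * p (\<nu>(j := \<nu> j + m))))"
    by (simp only: mult_ac)
qed


section \<open>Fourier analysis on exponents modulo \<open>m\<close>\<close>

text \<open>
  Reduce the coordinates one after the other, by induction on the set of those already reduced.
\<close>

lemma periodic_mod:
  fixes f :: "('n::finite \<Rightarrow> nat) \<Rightarrow> 'b"
  assumes per: "\<And>\<nu> j. f (\<nu>(j := \<nu> j + m)) = f \<nu>"
  shows "f \<nu> = f (\<lambda>j. \<nu> j mod m)"
proof -
  have shift: "f (\<nu>(j := a + m * k)) = f (\<nu>(j := a))" for \<nu> j a k
  proof (induction k)
    case (Suc k)
    have "f (\<nu>(j := a + m * Suc k)) = f ((\<nu>(j := a + m * k))(j := (\<nu>(j := a + m * k)) j + m))"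
      by (simp add: add_ac)
    also have "\<dots> = f (\<nu>(j := a + m * k))" by (rule per)
    finally show ?case by (simp only: Suc)
  qed simp
  have "f \<nu> = f (\<lambda>j. if j \<in> A then \<nu> j mod m else \<nu> j)" if "finite A" for A
    using that
  proof (induction A)
    case (insert i A)
    define \<kappa> where "\<kappa> = (\<lambda>j. if j \<in> A then \<nu> j mod m else \<nu> j)"
    have "\<kappa> = \<kappa>(i := \<nu> i mod m + m * (\<nu> i div m))"
      using insert.hyps by (auto simp: \<kappa>_def fun_eq_iff)
    then have "f \<kappa> = f (\<kappa>(i := \<nu> i mod m))" using shift by metis
    also have "\<kappa>(i := \<nu> i mod m) = (\<lambda>j. if j \<in> insert i A then \<nu> j mod m else \<nu> j)"
      by (auto simp: \<kappa>_def fun_eq_iff)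
    finally show ?case using insert.IH by (simp only: \<kappa>_def)
  qed simp
  from this[of UNIV] show ?thesis by simp
qed

lemma mellin_eps_powi: "mellin_eps m powi d = exp (of_int d * (2 * of_real pi * \<i> / of_nat m))"
  by (simp add: mellin_eps_def exp_power_int)

lemma mellin_eps_nonzero: "mellin_eps m \<noteq> 0"
  by (simp add: mellin_eps_def)

lemma mellin_eps_powi_eq_1:
  assumes "0 < m"
  shows "mellin_eps m powi d = 1 \<longleftrightarrow> int m dvd d"
proof -
  have "mellin_eps m powi d = 1 \<longleftrightarrow> (\<exists>n::int. 2 * pi * of_int d / of_nat m = of_int (2 * n) * pi)"
    unfolding mellin_eps_powi exp_eq_1 by (simp add: mult_ac Im_divide_of_nat Re_divide_of_nat)
  also have "\<dots> \<longleftrightarrow> (\<exists>n::int. real_of_int d = real_of_int (int m * n))"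
    using assms by (simp add: field_simps)
  also have "\<dots> \<longleftrightarrow> int m dvd d"
    unfolding of_int_eq_iff dvd_def ..
  finally show ?thesis .
qed

lemma norm_mellin_eps_powi: "norm (mellin_eps m powi d) = 1"
proof -
  have "mellin_eps m powi d = exp (\<i> * of_real (of_int d * (2 * pi / of_nat m)))"
    unfolding mellin_eps_powi by (simp add: mult_ac)
  then show ?thesis by (simp only: norm_exp_i_times)
qed

text \<open>
  A geometric sum with ratio \<open>\<epsilon>\<^sup>d\<close>, an \<open>m\<close>-th root of unity.
\<close>

lemma sum_roots_of_unity:
  assumes "0 < m"
  shows "(\<Sum>k<m. mellin_eps m powi (d * int k)) = (if int m dvd d then of_nat m else 0)"
proof -
  define z where "z = mellin_eps m powi d"
  have zk: "mellin_eps m powi (d * int k) = z ^ k" for k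
    by (simp add: z_def power_int_mult)
  have "z ^ m = 1"
    unfolding zk[symmetric] mellin_eps_powi_eq_1[OF assms] by simp
  moreover have "z = 1 \<longleftrightarrow> int m dvd d" by (simp add: z_def mellin_eps_powi_eq_1[OF assms])
  ultimately show ?thesis unfolding zk by (auto simp: sum_gp_strict)
qed

text \<open>
  The characters of \<open>(\<int>/m)\<^sup>n\<close>, and at the same time the factor by which the rotation with index \<open>i\<close>
  multiplies the monomial \<open>x\<^sup>\<nu>\<close>. The index is a vector of integers and may be negated.
\<close>

definition mellin_character :: "nat \<Rightarrow> ('n::finite \<Rightarrow> int) \<Rightarrow> ('n \<Rightarrow> nat) \<Rightarrow> complex" where
  "mellin_character m i \<nu> = (\<Prod>j\<in>UNIV. mellin_eps m powi (i j * int (\<nu> j)))"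

lemma mellin_B_PiE: "mellin_B m = PiE UNIV (\<lambda>_. {0..int m - 1})"
  by (auto simp: mellin_B_def PiE_def)

lemma finite_mellin_B: "finite (mellin_B m :: ('n::finite \<Rightarrow> int) set)"
  unfolding mellin_B_PiE by (intro finite_PiE) auto

abbreviation residue_exponents :: "nat \<Rightarrow> ('n::finite \<Rightarrow> nat) set" where
  "residue_exponents m \<equiv> PiE UNIV (\<lambda>_. {..<m})"

lemma mellin_character_periodic:
  assumes "0 < m"
  shows "mellin_character m i (\<nu>(j := \<nu> j + m)) = mellin_character m i \<nu>"
  unfolding mellin_character_def
proof (rule prod.cong[OF refl])
  fix l
  have "mellin_eps m powi (i j * int (\<nu> j + m)) = mellin_eps m powi (i j * int (\<nu> j)) * mellin_eps m powi (i j * int m)"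
    by (simp add: power_int_add[symmetric] mellin_eps_nonzero distrib_left)
  also have "mellin_eps m powi (i j * int m) = 1" using mellin_eps_powi_eq_1[OF assms] by simp
  finally show "mellin_eps m powi (i l * int ((\<nu>(j := \<nu> j + m)) l)) = mellin_eps m powi (i l * int (\<nu> l))"
    by simp
qed

lemma mellin_character_mult_inverse:
  "mellin_character m (\<lambda>j. - i j) \<kappa> * mellin_character m l \<nu> =
     (\<Prod>j\<in>UNIV. mellin_eps m powi (l j * int (\<nu> j) - i j * int (\<kappa> j)))"
  unfolding mellin_character_def prod.distrib[symmetric]
  by (rule prod.cong[OF refl]) (simp add: power_int_add[symmetric] mellin_eps_nonzero)

text \<open>
  Orthogonality summed over exponents; it extracts the weights of a linear combination and yields
  independence.
\<close>

lemma mellin_character_orthogonal_exponents: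
  fixes i l :: "'n::finite \<Rightarrow> int"
  assumes m: "0 < m" and i: "i \<in> mellin_B m" and l: "l \<in> mellin_B m"
  shows "(\<Sum>\<kappa>\<in>residue_exponents m. mellin_character m (\<lambda>j. - i j) \<kappa> * mellin_character m l \<kappa>) =
     (if i = l then of_nat m ^ CARD('n) else 0)"
proof -
  have "(\<Sum>\<kappa>\<in>residue_exponents m. mellin_character m (\<lambda>j. - i j) \<kappa> * mellin_character m l \<kappa>) =
      (\<Sum>\<kappa>\<in>residue_exponents m. \<Prod>j\<in>UNIV. mellin_eps m powi ((l j - i j) * int (\<kappa> j)))"
    unfolding mellin_character_mult_inverse by (simp add: algebra_simps)
  also have "\<dots> = (\<Prod>j\<in>UNIV. \<Sum>k<m. mellin_eps m powi ((l j - i j) * int k))"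
    by (subst prod_sum_PiE) auto
  also have "\<dots> = (\<Prod>j\<in>(UNIV::'n set). if i j = l j then of_nat m else 0)"
  proof (rule prod.cong[OF refl])
    fix j
    have "\<bar>l j - i j\<bar> < int m" using i l unfolding mellin_B_def by (smt (verit) mem_Collect_eq)
    then have "int m dvd l j - i j \<longleftrightarrow> i j = l j" using dvd_imp_le_int[of "l j - i j" "int m"] by fastforce
    then show "(\<Sum>k<m. mellin_eps m powi ((l j - i j) * int k)) = (if i j = l j then of_nat m else 0)"
      unfolding sum_roots_of_unity[OF m] by simp
  qed
  also have "\<dots> = (if i = l then of_nat m ^ CARD('n) else 0)"
    by (auto simp: fun_eq_iff intro!: prod_zero)
  finally show ?thesis .
qed

text \<open>Dual orthogonality summed over indices; it yields the Fourier expansion.\<close>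

lemma mellin_character_orthogonal_indices:
  fixes \<kappa> \<nu> :: "'n::finite \<Rightarrow> nat"
  assumes m: "0 < m" and \<kappa>: "\<kappa> \<in> residue_exponents m"
  shows "(\<Sum>i\<in>mellin_B m. mellin_character m (\<lambda>j. - i j) \<kappa> * mellin_character m i \<nu>) =
     (if \<kappa> = (\<lambda>j. \<nu> j mod m) then of_nat m ^ CARD('n) else 0)"
proof -
  have "(\<Sum>i\<in>mellin_B m. mellin_character m (\<lambda>j. - i j) \<kappa> * mellin_character m i \<nu>) =
      (\<Sum>i\<in>mellin_B m. \<Prod>j\<in>UNIV. mellin_eps m powi ((int (\<nu> j) - int (\<kappa> j)) * i j))"
    unfolding mellin_character_mult_inverse by (simp add: algebra_simps)
  also have "\<dots> = (\<Prod>j\<in>UNIV. \<Sum>a\<in>{0..int m - 1}. mellin_eps m powi ((int (\<nu> j) - int (\<kappa> j)) * a))"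
    unfolding mellin_B_PiE by (subst prod_sum_PiE) auto
  also have "\<dots> = (\<Prod>j\<in>(UNIV::'n set). if \<kappa> j = \<nu> j mod m then of_nat m else 0)"
  proof (rule prod.cong[OF refl])
    fix j
    have "(\<Sum>a\<in>{0..int m - 1}. mellin_eps m powi ((int (\<nu> j) - int (\<kappa> j)) * a)) =
        (\<Sum>k<m. mellin_eps m powi ((int (\<nu> j) - int (\<kappa> j)) * int k))"
      by (rule sum.reindex_bij_witness[of _ int nat]) auto
    also have "\<dots> = (if int m dvd int (\<nu> j) - int (\<kappa> j) then of_nat m else 0)"
      by (rule sum_roots_of_unity[OF m])
    also have "int m dvd int (\<nu> j) - int (\<kappa> j) \<longleftrightarrow> \<kappa> j = \<nu> j mod m"
    proof -
      have "int m dvd int (\<nu> j) - int (\<kappa> j) \<longleftrightarrow> \<nu> j mod m = \<kappa> j mod m"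
        by (metis mod_eq_dvd_iff of_nat_eq_iff zmod_int)
      also have "\<kappa> j mod m = \<kappa> j" using PiE_mem[OF \<kappa>, of j] by simp
      finally show ?thesis by auto
    qed
    finally show "(\<Sum>a\<in>{0..int m - 1}. mellin_eps m powi ((int (\<nu> j) - int (\<kappa> j)) * a)) =
        (if \<kappa> j = \<nu> j mod m then of_nat m else 0)" .
  qed
  also have "\<dots> = (if \<kappa> = (\<lambda>j. \<nu> j mod m) then of_nat m ^ CARD('n) else 0)"
    by (auto simp: fun_eq_iff intro!: prod_zero)
  finally show ?thesis .
qed

lemma mellin_character_expansion:
  fixes q :: "('n::finite \<Rightarrow> nat) \<Rightarrow> complex"
  assumes m: "0 < m" and per: "\<And>\<nu> j. q (\<nu>(j := \<nu> j + m)) = q \<nu>"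
  obtains w where "\<And>\<nu>. q \<nu> = (\<Sum>i\<in>mellin_B m. w i * mellin_character m i \<nu>)"
proof (rule that)
  fix \<nu> :: "'n \<Rightarrow> nat"
  define C :: complex where "C = of_nat m ^ CARD('n)"
  \<comment> \<open>The weights are the Fourier coefficients of \<open>q\<close>, normalised by the number \<open>C\<close> of characters.\<close>
  have C: "C \<noteq> 0" using m by (simp add: C_def)
  have mem: "(\<lambda>j. \<nu> j mod m) \<in> residue_exponents m" using m by auto
  have fin: "finite (residue_exponents m :: ('n \<Rightarrow> nat) set)" by (intro finite_PiE) auto
  have "(\<Sum>i\<in>mellin_B m. (\<Sum>\<kappa>\<in>residue_exponents m. q \<kappa> * mellin_character m (\<lambda>j. - i j) \<kappa>) / C * mellin_character m i \<nu>)
     = (\<Sum>i\<in>mellin_B m. \<Sum>\<kappa>\<in>residue_exponents m. q \<kappa> / C * (mellin_character m (\<lambda>j. - i j) \<kappa> * mellin_character m i \<nu>))"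
    unfolding sum_divide_distrib sum_distrib_right by (intro sum.cong refl) simp
  also have "\<dots> = (\<Sum>\<kappa>\<in>residue_exponents m. q \<kappa> / C * (\<Sum>i\<in>mellin_B m. mellin_character m (\<lambda>j. - i j) \<kappa> * mellin_character m i \<nu>))"
    unfolding sum_distrib_left by (rule sum.swap)
  also have "\<dots> = (\<Sum>\<kappa>\<in>residue_exponents m. if \<kappa> = (\<lambda>j. \<nu> j mod m) then q \<kappa> else 0)"
  proof (rule sum.cong[OF refl])
    fix \<kappa> :: "'n \<Rightarrow> nat" assume "\<kappa> \<in> residue_exponents m"
    from mellin_character_orthogonal_indices[OF m this, of \<nu>]
    show "q \<kappa> / C * (\<Sum>i\<in>mellin_B m. mellin_character m (\<lambda>j. - i j) \<kappa> * mellin_character m i \<nu>) =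
        (if \<kappa> = (\<lambda>j. \<nu> j mod m) then q \<kappa> else 0)"
      using C by (simp only: C_def[symmetric]) simp
  qed
  also have "\<dots> = q (\<lambda>j. \<nu> j mod m)" using fin mem by simp
  also have "\<dots> = q \<nu>" by (rule periodic_mod[OF per, symmetric])
  finally show "q \<nu> = (\<Sum>i\<in>mellin_B m. (\<Sum>\<kappa>\<in>residue_exponents m. q \<kappa> * mellin_character m (\<lambda>j. - i j) \<kappa>) / C * mellin_character m i \<nu>)"
    by (rule sym)
qed

lemma mellin_character_independent:
  fixes w :: "('n::finite \<Rightarrow> int) \<Rightarrow> complex"
  assumes m: "0 < m" and zero: "\<And>\<nu>. (\<Sum>i\<in>mellin_B m. w i * mellin_character m i \<nu>) = 0" and l: "l \<in> mellin_B m"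
  shows "w l = 0"
proof -
  define C :: complex where "C = of_nat m ^ CARD('n)"
  have C: "C \<noteq> 0" using m by (simp add: C_def)
  have "0 = (\<Sum>\<kappa>\<in>residue_exponents m. mellin_character m (\<lambda>j. - l j) \<kappa> * (\<Sum>i\<in>mellin_B m. w i * mellin_character m i \<kappa>))"
    unfolding zero by simp
  also have "\<dots> = (\<Sum>\<kappa>\<in>residue_exponents m. \<Sum>i\<in>mellin_B m. w i * (mellin_character m (\<lambda>j. - l j) \<kappa> * mellin_character m i \<kappa>))"
    unfolding sum_distrib_left by (intro sum.cong refl) (simp only: mult_ac)
  also have "\<dots> = (\<Sum>i\<in>mellin_B m. w i * (\<Sum>\<kappa>\<in>residue_exponents m. mellin_character m (\<lambda>j. - l j) \<kappa> * mellin_character m i \<kappa>))"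
    unfolding sum_distrib_left by (rule sum.swap)
  also have "\<dots> = (\<Sum>i\<in>mellin_B m. if i = l then w l * C else 0)"
  proof (rule sum.cong[OF refl])
    fix i :: "'n \<Rightarrow> int" assume "i \<in> mellin_B m"
    from mellin_character_orthogonal_exponents[OF m l this]
    show "w i * (\<Sum>\<kappa>\<in>residue_exponents m. mellin_character m (\<lambda>j. - l j) \<kappa> * mellin_character m i \<kappa>) =
        (if i = l then w l * C else 0)"
      by (simp only: C_def[symmetric]) auto
  qed
  also have "\<dots> = w l * C" by (simp add: finite_mellin_B l)
  finally show ?thesis using C by simp
qed


section \<open>The principal solution and its rotations\<close>

text \<open>Continuity in all variables jointly, as a uniform limit on a smaller polydisc.\<close>

lemma has_pseries_isCont_0:
  fixes c :: "('n::finite \<Rightarrow> nat) \<Rightarrow> complex"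
  assumes ps: "has_pseries c f \<rho>" and "0 < \<rho>"
  shows "isCont f 0"
proof -
  define \<sigma> where "\<sigma> = \<rho> / 2"
  have \<sigma>: "0 < \<sigma>" "\<sigma> < \<rho>" using assms(2) by (auto simp: \<sigma>_def)
  have "uniform_limit (polydisc \<sigma>) (\<lambda>X x. \<Sum>\<nu>\<in>X. c \<nu> * monomial \<nu> x) f (finite_subsets_at_top UNIV)"
  proof (rule Weierstrass_m_test_general')
    show "(\<lambda>\<nu>. norm (c \<nu>) * \<sigma> ^ mdeg \<nu>) summable_on UNIV"
      using has_pseries_abs_summable[OF ps, of \<sigma>] \<sigma> by simp
    show "norm (c \<nu> * monomial \<nu> x) \<le> norm (c \<nu>) * \<sigma> ^ mdeg \<nu>" if "x \<in> polydisc \<sigma>" for \<nu> x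
      unfolding norm_mult using that
      by (intro mult_left_mono norm_monomial_le) (auto simp: polydisc_def intro: less_imp_le)
    show "((\<lambda>\<nu>. c \<nu> * monomial \<nu> x) has_sum f x) UNIV" if "x \<in> polydisc \<sigma>" for x
      using has_pseries_mono[OF ps, of \<sigma>] \<sigma> that by (simp add: has_pseries_def)
  qed
  moreover have "continuous_on (polydisc \<sigma>) (\<lambda>x. \<Sum>\<nu>\<in>X. c \<nu> * monomial \<nu> x)" for X
    unfolding monomial_def by (intro continuous_intros)
  ultimately have "continuous_on (polydisc \<sigma>) f"
    by (intro uniform_limit_theorem[where F = "finite_subsets_at_top UNIV"]) auto
  then show ?thesis
    using zero_in_polydisc[OF \<sigma>(1)] open_polydisc continuous_on_eq_continuous_at by blast
qed

text \<open>
  Subtracting the two equations gives \<open>(y - z) H = 0\<close>, where \<open>H\<close> is continuous at the origin with value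
  \<open>m \<noteq> 0\<close> there.
\<close>

lemma root_near_1_unique:
  fixes \<mu> :: "'n::finite \<Rightarrow> nat" and y z :: "complex ^ 'n \<Rightarrow> complex"
  assumes m: "0 < m"
    and y: "isCont y 0" "y 0 = 1" "\<forall>\<^sub>F x in nhds 0. y x ^ m + (\<Sum>j\<in>UNIV. x $ j * y x ^ \<mu> j) - 1 = 0"
    and z: "isCont z 0" "z 0 = 1" "\<forall>\<^sub>F x in nhds 0. z x ^ m + (\<Sum>j\<in>UNIV. x $ j * z x ^ \<mu> j) - 1 = 0"
  shows "\<forall>\<^sub>F x in nhds 0. y x = z x"
proof -
  \<comment> \<open>\<open>S n = (y\<^sup>n - z\<^sup>n) / (y - z)\<close>, with value \<open>n\<close> at the origin.\<close>
  define S where "S n x = (\<Sum>i<n. z x ^ (n - Suc i) * y x ^ i)" for n x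
  define H where "H x = S m x + (\<Sum>j\<in>UNIV. x $ j * S (\<mu> j) x)" for x
  have "isCont H 0"
    unfolding H_def S_def by (intro continuous_intros y z)
  then have "(H \<longlongrightarrow> H 0) (nhds 0)" by (simp add: continuous_at tendsto_nhds_iff)
  moreover have "H 0 = of_nat m" by (simp add: H_def S_def y z)
  ultimately have "\<forall>\<^sub>F x in nhds 0. H x \<noteq> 0"
    using m by (intro tendsto_imp_eventually_ne[where c = "H 0"]) auto
  then show ?thesis using y(3) z(3)
  proof eventually_elim
    case (elim x)
    have S: "y x ^ n - z x ^ n = (y x - z x) * S n x" for n
      unfolding S_def by (rule power_diff_sumr2)
    have "0 = (y x ^ m + (\<Sum>j\<in>UNIV. x $ j * y x ^ \<mu> j) - 1) - (z x ^ m + (\<Sum>j\<in>UNIV. x $ j * z x ^ \<mu> j) - 1)"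
      unfolding elim(2,3) by simp
    also have "\<dots> = (y x ^ m - z x ^ m) + (\<Sum>j\<in>UNIV. x $ j * (y x ^ \<mu> j - z x ^ \<mu> j))"
      by (simp add: right_diff_distrib sum_subtractf)
    also have "\<dots> = (y x - z x) * H x"
      unfolding S H_def distrib_left sum_distrib_left by (simp add: mult_ac)
    finally show ?case using elim(1) by simp
  qed
qed

lemma root_radius_pos: "0 < root_radius TYPE('n::finite)"
  by (simp add: root_radius_def)

lemma eventually_polydisc: "0 < \<rho> \<Longrightarrow> (\<And>x. x \<in> polydisc \<rho> \<Longrightarrow> P x) \<Longrightarrow> \<forall>\<^sub>F x in nhds 0. P x"
  unfolding eventually_nhds using open_polydisc zero_in_polydisc by blast

lemma is_principal_solution_root_series:
  fixes \<mu> :: "'n::finite \<Rightarrow> nat"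
  assumes m: "0 < m" and \<mu>: "\<And>j. \<mu> j \<le> m"
  shows "is_principal_solution m \<mu> (root_series m \<mu> 1)"
proof -
  let ?U = "polydisc (root_radius TYPE('n)) :: (complex ^ 'n) set"
  have ps: "has_pseries (root_coeff m \<mu> (of_nat 1)) (root_series m \<mu> 1) (root_radius TYPE('n))"
    using m by (intro has_pseries_root_series \<mu>) auto
  have "root_series m \<mu> 1 0 = 1"
    using has_pseries_at_0[OF ps root_radius_pos] by (simp add: root_coeff_def)
  moreover have "mv_analytic_on (root_series m \<mu> 1) ?U"
    by (rule has_pseries_imp_mv_analytic[OF ps])
  moreover have "\<forall>x\<in>?U. root_series m \<mu> 1 x ^ m + (\<Sum>j\<in>UNIV. x $ j * root_series m \<mu> 1 x ^ \<mu> j) - 1 = 0"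
    using root_series_equation[of m \<mu>, OF m \<mu>] by (rule ballI)
  ultimately show ?thesis
    unfolding is_principal_solution_def using open_polydisc zero_in_polydisc[OF root_radius_pos] by blast
qed

text \<open>
  \<open>y_pr\<close> is known only through its defining property, which determines its germ.
\<close>

lemma y_pr_eq_root_series:
  fixes \<mu> :: "'n::finite \<Rightarrow> nat"
  assumes m: "0 < m" and \<mu>: "\<And>j. \<mu> j \<le> m"
  shows "\<forall>\<^sub>F x in nhds 0. y_pr m \<mu> x = root_series m \<mu> 1 x"
proof -
  have pr: "is_principal_solution m \<mu> (y_pr m \<mu>)"
    unfolding y_pr_def
    by (rule someI[of "is_principal_solution m \<mu>", OF is_principal_solution_root_series[of m \<mu>, OF m \<mu>]])
  have cont: "isCont y 0" and at_0: "y 0 = 1"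
    and eqn: "\<forall>\<^sub>F x in nhds 0. y x ^ m + (\<Sum>j\<in>UNIV. x $ j * y x ^ \<mu> j) - 1 = 0"
    if y: "is_principal_solution m \<mu> y" for y
  proof -
    from y obtain U where U: "open U" "0 \<in> U" "mv_analytic_on y U"
      "\<forall>x\<in>U. y x ^ m + (\<Sum>j\<in>UNIV. x $ j * y x ^ \<mu> j) - 1 = 0"
      unfolding is_principal_solution_def by blast
    obtain c \<rho> where "0 < \<rho>" "has_pseries c y \<rho>"
      by (rule mv_analytic_imp_has_pseries[OF U(3,1,2)])
    then show "isCont y 0" by (intro has_pseries_isCont_0)
    show "y 0 = 1" using y by (simp add: is_principal_solution_def)
    show "\<forall>\<^sub>F x in nhds 0. y x ^ m + (\<Sum>j\<in>UNIV. x $ j * y x ^ \<mu> j) - 1 = 0"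
      unfolding eventually_nhds using U by blast
  qed
  note sol = is_principal_solution_root_series[of m \<mu>, OF m \<mu>]
  show ?thesis
    by (rule root_near_1_unique[OF m cont[OF pr] at_0[OF pr] eqn[OF pr] cont[OF sol] at_0[OF sol] eqn[OF sol]])
qed

definition rotation :: "nat \<Rightarrow> ('n::finite \<Rightarrow> int) \<Rightarrow> complex ^ 'n \<Rightarrow> complex ^ 'n" where
  "rotation m i x = (\<chi> j. mellin_eps m powi i j * x $ j)"

lemma rotation_in_polydisc: "rotation m i x \<in> polydisc \<rho> \<longleftrightarrow> x \<in> polydisc \<rho>"
  by (simp add: rotation_def polydisc_def norm_mult norm_mellin_eps_powi)

lemma monomial_rotation: "monomial \<nu> (rotation m i x) = mellin_character m i \<nu> * monomial \<nu> x"
  by (simp add: monomial_def rotation_def mellin_character_def power_mult_distrib prod.distrib power_int_mult)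

lemma has_pseries_rotation:
  fixes f :: "complex ^ 'a::finite \<Rightarrow> complex"
  shows   "has_pseries c f \<rho> \<Longrightarrow> has_pseries (\<lambda>\<nu>. mellin_character m i \<nu> * c \<nu>) (\<lambda>x. f (rotation m i x)) \<rho>"
  unfolding has_pseries_def
proof
  fix x :: "complex ^ 'a" assume *: "\<forall>x\<in>polydisc \<rho>. ((\<lambda>\<nu>. c \<nu> * monomial \<nu> x) has_sum f x) UNIV" "x \<in> polydisc \<rho>"
  then have "((\<lambda>\<nu>. c \<nu> * monomial \<nu> (rotation m i x)) has_sum f (rotation m i x)) UNIV"
    by (simp only: rotation_in_polydisc)
  then show "((\<lambda>\<nu>. mellin_character m i \<nu> * c \<nu> * monomial \<nu> x) has_sum f (rotation m i x)) UNIV"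
    unfolding monomial_rotation by (simp only: mult_ac)
qed

definition root_combination ::
  "nat \<Rightarrow> ('n::finite \<Rightarrow> nat) \<Rightarrow> (('n \<Rightarrow> int) \<Rightarrow> complex) \<Rightarrow> complex ^ 'n \<Rightarrow> complex" where
  "root_combination m \<mu> w x = (\<Sum>i\<in>mellin_B m. w i * root_series m \<mu> 1 (rotation m i x))"

lemma has_pseries_root_combination:
  fixes \<mu> :: "'n::finite \<Rightarrow> nat"
  assumes m: "0 < m" and \<mu>: "\<And>j. \<mu> j \<le> m"
  shows "has_pseries (\<lambda>\<nu>. (\<Sum>i\<in>mellin_B m. w i * mellin_character m i \<nu>) * root_coeff m \<mu> 1 \<nu>)
      (root_combination m \<mu> w) (root_radius TYPE('n))"
proof -
  have "has_pseries (root_coeff m \<mu> (of_nat 1)) (root_series m \<mu> 1) (root_radius TYPE('n))"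
    using m by (intro has_pseries_root_series \<mu>) auto
  then have "has_pseries (root_coeff m \<mu> 1) (root_series m \<mu> 1) (root_radius TYPE('n))"
    by (simp only: of_nat_1)
  then have "has_pseries (\<lambda>\<nu>. \<Sum>i\<in>mellin_B m. w i * (mellin_character m i \<nu> * root_coeff m \<mu> 1 \<nu>))
      (\<lambda>x. \<Sum>i\<in>mellin_B m. w i * root_series m \<mu> 1 (rotation m i x)) (root_radius TYPE('n))"
    by (intro has_pseries_sum has_pseries_cmult has_pseries_rotation)
  then show ?thesis
    unfolding root_combination_def[abs_def] sum_distrib_right mult.assoc .
qed

text \<open>
  Characters are periodic modulo \<open>m\<close>, so they may be absorbed into the recurrence.
\<close>

lemma root_combination_solution:
  fixes \<mu> :: "'n::finite \<Rightarrow> nat"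
  assumes m: "0 < m" and \<mu>: "\<And>j. \<mu> j \<le> m"
  shows "mellin_solution_on m \<mu> (polydisc (root_radius TYPE('n))) (root_combination m \<mu> w)"
proof (rule recurrence_imp_mellin_solution[OF has_pseries_root_combination[of m \<mu>, OF m \<mu>]])
  show "mellin_recurrence m \<mu> (\<lambda>\<nu>. (\<Sum>i\<in>mellin_B m. w i * mellin_character m i \<nu>) * root_coeff m \<mu> 1 \<nu>)"
    by (rule mellin_recurrence_periodic_mult[OF mellin_recurrence_root_coeff[of m \<mu>, OF m \<mu>]])
      (simp only: mellin_character_periodic[OF m])
qed

text \<open>
  The quotient of the coefficients by those of the principal solution is periodic, hence a combination
  of characters, and the weights of this combination are those of the rotated principal solutions.
\<close>

lemma mellin_solution_imp_root_combination:
  fixes \<mu> :: "'n::finite \<Rightarrow> nat"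
  assumes m: "0 < m" and \<mu>: "\<And>j. \<mu> j \<le> m" and nz: "\<And>\<nu>. root_coeff m \<mu> 1 \<nu> \<noteq> 0"
    and U: "open U" "0 \<in> U" and sol: "mellin_solution_on m \<mu> U f"
  obtains w where "\<forall>\<^sub>F x in nhds 0. f x = root_combination m \<mu> w x"
proof -
  have "mv_analytic_on f U" using sol by (simp add: mellin_solution_on_def)
  then obtain c \<rho> where \<rho>: "0 < \<rho>" "polydisc \<rho> \<subseteq> U" and ps: "has_pseries c f \<rho>"
    using U by (rule mv_analytic_imp_has_pseries)
  define q where "q \<nu> = c \<nu> / root_coeff m \<mu> 1 \<nu>" for \<nu>
  have "mellin_recurrence m \<mu> c" by (rule mellin_solution_imp_recurrence[OF ps \<rho>(1) sol \<rho>(2)])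
  then have "q (\<nu>(j := \<nu> j + m)) = q \<nu>" for \<nu> j
    unfolding q_def by (rule mellin_recurrence_ratio_periodic[OF _ mellin_recurrence_root_coeff[of m \<mu>, OF m \<mu>] nz m])
  then obtain w where w: "\<And>\<nu>. q \<nu> = (\<Sum>i\<in>mellin_B m. w i * mellin_character m i \<nu>)"
    by (rule mellin_character_expansion[OF m]) blast
  have c: "c = (\<lambda>\<nu>. (\<Sum>i\<in>mellin_B m. w i * mellin_character m i \<nu>) * root_coeff m \<mu> 1 \<nu>)"
    unfolding w[symmetric] q_def using nz by (simp add: fun_eq_iff)
  have ps': "has_pseries c (root_combination m \<mu> w) (root_radius TYPE('n))"
    by (subst c) (rule has_pseries_root_combination[of m \<mu>, OF m \<mu>])
  define r where "r = min \<rho> (root_radius TYPE('n))"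
  have r: "0 < r" "r \<le> \<rho>" "r \<le> root_radius TYPE('n)" using \<rho>(1) root_radius_pos by (auto simp: r_def)
  have "f x = root_combination m \<mu> w x" if "x \<in> polydisc r" for x
    by (rule has_pseries_fun_unique[OF has_pseries_mono[OF ps r(2)]
          has_pseries_mono[OF ps' r(3)] that])
  then have "\<forall>\<^sub>F x in nhds 0. f x = root_combination m \<mu> w x"
    by (rule eventually_polydisc[OF r(1)])
  then show ?thesis by (rule that)
qed


section \<open>The basis of germs\<close>

lemma germ_of_eq_iff: "germ_of f = germ_of g \<longleftrightarrow> (\<forall>\<^sub>F x in nhds 0. f x = g x)"
  unfolding germ.abs_eq_iff germ_eq_def ..

lemma germ_of_sum: "(\<Sum>i\<in>I. scale_germ (w i) (germ_of (F i))) = germ_of (\<lambda>x. \<Sum>i\<in>I. w i * F i x)"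
  by (induction I rule: infinite_finite_induct)
    (simp_all add: zero_germ.abs_eq plus_germ.abs_eq scale_germ.abs_eq)

lemma germ_of_y_pr_rotated:
  fixes \<mu> :: "'n::finite \<Rightarrow> nat"
  assumes m: "0 < m" and \<mu>: "\<And>j. \<mu> j \<le> m"
  shows "germ_of (y_pr_rotated m \<mu> i) = germ_of (\<lambda>x. root_series m \<mu> 1 (rotation m i x))"
proof -
  obtain V where V: "open V" "0 \<in> V" "\<And>x. x \<in> V \<Longrightarrow> y_pr m \<mu> x = root_series m \<mu> 1 x"
    using y_pr_eq_root_series[of m \<mu>, OF m \<mu>] unfolding eventually_nhds by blast
  obtain \<rho> where \<rho>: "0 < \<rho>" "polydisc \<rho> \<subseteq> V" by (rule polydisc_in_open[OF V(1,2)])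
  have "y_pr_rotated m \<mu> i x = root_series m \<mu> 1 (rotation m i x)" if "x \<in> polydisc \<rho>" for x
  proof -
    have "rotation m i x \<in> V" using that \<rho>(2) rotation_in_polydisc by blast
    from V(3)[OF this] show ?thesis by (simp add: y_pr_rotated_def rotation_def)
  qed
  then show ?thesis
    unfolding germ_of_eq_iff by (rule eventually_polydisc[OF \<rho>(1)])
qed

lemma germ_combination:
  fixes \<mu> :: "'n::finite \<Rightarrow> nat"
  assumes m: "0 < m" and \<mu>: "\<And>j. \<mu> j \<le> m"
  shows "(\<Sum>i\<in>mellin_B m. scale_germ (w i) (germ_of (y_pr_rotated m \<mu> i))) = germ_of (root_combination m \<mu> w)"
  unfolding germ_of_y_pr_rotated[of m \<mu>, OF m \<mu>] germ_of_sum root_combination_def ..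

text \<open>
  Independence of the indexed family rather than of the set of germs: it contains the distinctness of
  the germs as well.
\<close>

lemma rotated_germs_family_independent:
  fixes \<mu> :: "'n::finite \<Rightarrow> nat"
  assumes m: "0 < m" and \<mu>: "\<And>j. \<mu> j \<le> m" and nz: "\<And>\<nu>. root_coeff m \<mu> 1 \<nu> \<noteq> 0"
    and zero: "(\<Sum>i\<in>mellin_B m. scale_germ (w i) (germ_of (y_pr_rotated m \<mu> i))) = 0"
    and i: "i \<in> mellin_B m"
  shows "w i = 0"
proof -
  have "\<forall>\<^sub>F x in nhds 0. root_combination m \<mu> w x = 0"
    using zero unfolding germ_combination[of m \<mu>, OF m \<mu>] zero_germ.abs_eq germ_of_eq_iff .
  then obtain V where V: "open V" "0 \<in> V" "\<And>x. x \<in> V \<Longrightarrow> root_combination m \<mu> w x = 0"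
    unfolding eventually_nhds by blast
  obtain \<rho> where \<rho>: "0 < \<rho>" "polydisc \<rho> \<subseteq> V \<inter> polydisc (root_radius TYPE('n))"
  proof (rule polydisc_in_open)
    show "open (V \<inter> polydisc (root_radius TYPE('n)))" by (intro open_Int V open_polydisc)
    show "0 \<in> V \<inter> polydisc (root_radius TYPE('n))" using V(2) zero_in_polydisc[OF root_radius_pos] by blast
  qed
  have "has_pseries (\<lambda>\<nu>. (\<Sum>i\<in>mellin_B m. w i * mellin_character m i \<nu>) * root_coeff m \<mu> 1 \<nu>) (\<lambda>_. 0) \<rho>"
    unfolding has_pseries_def
  proof
    fix x :: "complex ^ 'n" assume "x \<in> polydisc \<rho>"
    then have "x \<in> V" "x \<in> polydisc (root_radius TYPE('n))" using \<rho>(2) by auto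
    then show "((\<lambda>\<nu>. (\<Sum>i\<in>mellin_B m. w i * mellin_character m i \<nu>) * root_coeff m \<mu> 1 \<nu> * monomial \<nu> x) has_sum 0) UNIV"
      using has_pseries_root_combination[of m \<mu>, OF m \<mu>, of w] V(3)[of x] unfolding has_pseries_def by fastforce
  qed
  from has_pseries_zero_imp[OF this \<rho>(1)]
  have "(\<Sum>i\<in>mellin_B m. w i * mellin_character m i \<nu>) = 0" for \<nu>
    using nz by simp
  then show ?thesis by (rule mellin_character_independent[OF m _ i])
qed

theorem rotated_germs_basis:
  fixes \<mu> :: "'n::finite \<Rightarrow> nat"
  assumes m: "0 < m" and \<mu>: "\<And>j. \<mu> j \<le> m" and nz: "\<And>\<nu>. root_coeff m \<mu> 1 \<nu> \<noteq> 0"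
  defines "G \<equiv> \<lambda>i. germ_of (y_pr_rotated m \<mu> i)"
  shows "inj_on G (mellin_B m)"
    and "germ.independent (G ` mellin_B m)"
    and "germ.span (G ` mellin_B m) = mellin_solution_space m \<mu>"
proof -
  have ind: "w i = 0" if "(\<Sum>i\<in>mellin_B m. scale_germ (w i) (G i)) = 0" "i \<in> mellin_B m" for w i
    using rotated_germs_family_independent[of m \<mu>, OF m \<mu> nz, of w i] that unfolding G_def .
  show inj: "inj_on G (mellin_B m)"
  proof (rule inj_onI, rule ccontr)
    fix i l assume il: "i \<in> mellin_B m" "l \<in> mellin_B m" "G i = G l" "i \<noteq> l"
    \<comment> \<open>Coinciding germs give the nontrivial relation \<open>G i - G l = 0\<close>.\<close>
    define w :: "('n \<Rightarrow> int) \<Rightarrow> complex" where "w = (\<lambda>k. if k = i then 1 else if k = l then - 1 else 0)"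
    have "(\<Sum>k\<in>mellin_B m. scale_germ (w k) (G k)) = (\<Sum>k\<in>{i, l}. scale_germ (w k) (G k))"
      by (rule sum.mono_neutral_right) (use il finite_mellin_B in \<open>auto simp: w_def\<close>)
    also have "\<dots> = 0" using il by (simp add: w_def)
    finally have "w i = 0" by (rule ind) fact
    then show False by (simp add: w_def)
  qed
  have fin: "finite (G ` mellin_B m)" by (intro finite_imageI finite_mellin_B)
  have reindex: "(\<Sum>v\<in>G ` mellin_B m. scale_germ (u v) v) = (\<Sum>i\<in>mellin_B m. scale_germ (u (G i)) (G i))" for u
    using sum.reindex[OF inj] by simp
  show "germ.independent (G ` mellin_B m)"
    unfolding germ.dependent_finite[OF fin] reindex
  proof (rule notI, elim exE conjE bexE)
    fix u v assume zero: "(\<Sum>i\<in>mellin_B m. scale_germ (u (G i)) (G i)) = 0"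
      and v: "v \<in> G ` mellin_B m" "u v \<noteq> 0"
    then obtain i where "i \<in> mellin_B m" "v = G i" by blast
    with ind[of "\<lambda>i. u (G i)", OF zero] v(2) show False by blast
  qed
  show "germ.span (G ` mellin_B m) = mellin_solution_space m \<mu>"
  proof (intro equalityI subsetI)
    fix g assume "g \<in> germ.span (G ` mellin_B m)"
    then obtain u where "g = (\<Sum>i\<in>mellin_B m. scale_germ (u (G i)) (G i))"
      unfolding germ.span_finite[OF fin] reindex by blast
    then have "g = germ_of (root_combination m \<mu> (\<lambda>i. u (G i)))"
      unfolding G_def germ_combination[of m \<mu>, OF m \<mu>] .
    then show "g \<in> mellin_solution_space m \<mu>"
      unfolding mellin_solution_space_def
      using root_combination_solution[of m \<mu>, OF m \<mu>] open_polydisc zero_in_polydisc[OF root_radius_pos] by blast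
  next
    fix g assume "g \<in> mellin_solution_space m \<mu>"
    then obtain f U where f: "g = germ_of f" "open U" "0 \<in> U" "mellin_solution_on m \<mu> U f"
      unfolding mellin_solution_space_def by blast
    obtain w where "\<forall>\<^sub>F x in nhds 0. f x = root_combination m \<mu> w x"
      by (rule mellin_solution_imp_root_combination[of m \<mu>, OF m \<mu> nz f(2-4)])
    then have "g = (\<Sum>i\<in>mellin_B m. scale_germ (w i) (G i))"
      unfolding f(1) G_def germ_combination[of m \<mu>, OF m \<mu>] germ_of_eq_iff .
    then show "g \<in> germ.span (G ` mellin_B m)"
      by (simp only:) (intro germ.span_sum germ.span_scale germ.span_base imageI)
  qed
qed


section \<open>Functions integral over the polynomials\<close>

lemma polynomial_map_monomial: "polynomial_map (\<lambda>x. c * monomial \<nu> x)"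
  unfolding polynomial_map_def by (intro exI[of _ "{\<nu>}"] exI[of _ "\<lambda>_. c"]) auto

lemma polynomial_map_const: "polynomial_map (\<lambda>x. c)"
  using polynomial_map_monomial[of c "\<lambda>_. 0"] by (simp add: monomial_def)

lemma polynomial_map_coord: "polynomial_map (\<lambda>x :: complex ^ 'n::finite. x $ j)"
proof -
  have "monomial (\<lambda>i. if i = j then 1 else 0) x = x $ j" for x :: "complex ^ 'n"
    unfolding monomial_def by (subst prod.remove[of _ j]) (auto intro!: prod.neutral)
  then show ?thesis using polynomial_map_monomial[of 1 "\<lambda>i. if i = j then 1 else 0"] by simp
qed

lemma polynomial_map_add:
  assumes "polynomial_map p" "polynomial_map q"
  shows "polynomial_map (\<lambda>x. p x + q x)"
proof -
  obtain S c where p: "finite S" "p = (\<lambda>x. \<Sum>\<nu>\<in>S. c \<nu> * monomial \<nu> x)"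
    using assms(1) by (auto simp: polynomial_map_def)
  obtain T d where q: "finite T" "q = (\<lambda>x. \<Sum>\<nu>\<in>T. d \<nu> * monomial \<nu> x)"
    using assms(2) by (auto simp: polynomial_map_def)
  define e where "e \<nu> = (if \<nu> \<in> S then c \<nu> else 0) + (if \<nu> \<in> T then d \<nu> else 0)" for \<nu>
  have "p x + q x = (\<Sum>\<nu>\<in>S \<union> T. e \<nu> * monomial \<nu> x)" for x
  proof -
    have "p x = (\<Sum>\<nu>\<in>S \<union> T. (if \<nu> \<in> S then c \<nu> else 0) * monomial \<nu> x)"
      unfolding p(2) by (rule sum.mono_neutral_cong_left) (use p q in auto)
    moreover have "q x = (\<Sum>\<nu>\<in>S \<union> T. (if \<nu> \<in> T then d \<nu> else 0) * monomial \<nu> x)"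
      unfolding q(2) by (rule sum.mono_neutral_cong_left) (use p q in auto)
    ultimately show ?thesis by (simp add: e_def distrib_right sum.distrib)
  qed
  then show ?thesis
    unfolding polynomial_map_def using p(1) q(1)
    by (intro exI[of _ "S \<union> T"] exI[of _ e]) auto
qed

lemma polynomial_map_sum:
  "(\<And>i. i \<in> I \<Longrightarrow> polynomial_map (p i)) \<Longrightarrow> polynomial_map (\<lambda>x. \<Sum>i\<in>I. p i x)"
  by (induction I rule: infinite_finite_induct) (simp_all add: polynomial_map_const polynomial_map_add)

lemma polynomial_map_mult:
  fixes p q :: "complex ^ 'n::finite \<Rightarrow> complex"
  assumes "polynomial_map p" "polynomial_map q"
  shows "polynomial_map (\<lambda>x. p x * q x)"
proof -
  obtain S c where p: "finite S" "p = (\<lambda>x. \<Sum>\<nu>\<in>S. c \<nu> * monomial \<nu> x)"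
    using assms(1) by (auto simp: polynomial_map_def)
  obtain T d where q: "finite T" "q = (\<lambda>x. \<Sum>\<nu>\<in>T. d \<nu> * monomial \<nu> x)"
    using assms(2) by (auto simp: polynomial_map_def)
  have eq: "p x * q x = (\<Sum>\<nu>\<in>S. \<Sum>\<kappa>\<in>T. (c \<nu> * d \<kappa>) * monomial (\<lambda>j. \<nu> j + \<kappa> j) x)" for x
    unfolding p(2) q(2) sum_product by (intro sum.cong refl) (simp add: monomial_mult[symmetric] mult_ac)
  show ?thesis
    unfolding eq by (intro polynomial_map_sum polynomial_map_monomial)
qed

lemma polynomial_map_uminus: "polynomial_map p \<Longrightarrow> polynomial_map (\<lambda>x. - p x)"
  using polynomial_map_mult[OF polynomial_map_const[of "- 1"]] by fastforce

text \<open>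
  Polynomials in one further variable \<open>T\<close> whose coefficients are polynomial functions of \<open>x\<close>.
\<close>

definition polynomial_family :: "(complex ^ 'n::finite \<Rightarrow> complex poly) \<Rightarrow> bool" where
  "polynomial_family Q \<longleftrightarrow> (\<forall>t. polynomial_map (\<lambda>x. coeff (Q x) t))"

lemma polynomial_family_const: "polynomial_family (\<lambda>x. c)"
  by (simp add: polynomial_family_def polynomial_map_const)

lemma polynomial_family_add: "polynomial_family P \<Longrightarrow> polynomial_family Q \<Longrightarrow> polynomial_family (\<lambda>x. P x + Q x)"
  by (simp add: polynomial_family_def polynomial_map_add)

lemma polynomial_family_mult: "polynomial_family P \<Longrightarrow> polynomial_family Q \<Longrightarrow> polynomial_family (\<lambda>x. P x * Q x)"
  by (simp add: polynomial_family_def coeff_mult polynomial_map_sum polynomial_map_mult)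

lemma polynomial_family_sum:
  "(\<And>i. i \<in> I \<Longrightarrow> polynomial_family (P i)) \<Longrightarrow> polynomial_family (\<lambda>x. \<Sum>i\<in>I. P i x)"
  by (induction I rule: infinite_finite_induct) (simp_all add: polynomial_family_const polynomial_family_add)

lemma polynomial_family_prod:
  "(\<And>i. i \<in> I \<Longrightarrow> polynomial_family (P i)) \<Longrightarrow> polynomial_family (\<lambda>x. \<Prod>i\<in>I. P i x)"
  by (induction I rule: infinite_finite_induct) (simp_all add: polynomial_family_const polynomial_family_mult)

lemma polynomial_family_scalar: "polynomial_map p \<Longrightarrow> polynomial_family (\<lambda>x. [:p x:])"
  unfolding polynomial_family_def
proof
  fix t assume "polynomial_map p"
  then show "polynomial_map (\<lambda>x. coeff [:p x:] t)"
    by (cases t) (simp_all add: polynomial_map_const)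
qed

text \<open>
  By the Leibniz formula, since the entries \<open>T \<delta>\<^sub>i\<^sub>l - A\<^sub>i\<^sub>l(x)\<close> are such families.
\<close>

lemma polynomial_family_char_poly:
  assumes A: "\<And>i l. i < k \<Longrightarrow> l < k \<Longrightarrow> polynomial_map (A i l)"
  shows "polynomial_family (\<lambda>x. char_poly (mat k k (\<lambda>(i, l). A i l x)))"
proof -
  have entry: "polynomial_family (\<lambda>x. char_poly_matrix (mat k k (\<lambda>(i, l). A i l x)) $$ (i, l))"
    if "i < k" "l < k" for i l
  proof -
    have "char_poly_matrix (mat k k (\<lambda>(i, l). A i l x)) $$ (i, l) = [:0, 1:] * (if i = l then 1 else 0) + [:- A i l x:]" for x
      using that by (simp add: char_poly_matrix_def)
    then show ?thesis
      using A[OF that]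
      by (simp only:) (intro polynomial_family_add polynomial_family_const polynomial_family_scalar polynomial_map_uminus)
  qed
  have dims: "dim_row (char_poly_matrix (mat k k (\<lambda>(i, l). A i l x))) = k"
    "dim_col (char_poly_matrix (mat k k (\<lambda>(i, l). A i l x))) = k" for x
    by (simp_all add: char_poly_matrix_def)
  show ?thesis
    unfolding char_poly_def Determinant.det_def dims
    unfolding eqTrueI[OF refl] if_True
  proof (intro polynomial_family_sum polynomial_family_mult polynomial_family_prod polynomial_family_const entry)
    fix p i assume "p \<in> {p. p permutes {0..<k}}" and i: "i \<in> {0..<k}"
    then show "p i < k" using permutes_in_image[of p "{0..<k}" i] by auto
    show "i < k" using i by simp
  qed
qed

text \<open>
  Integrality in the form of a finitely generated module: the \<open>w\<^sub>i\<close> generate a module over the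
  polynomials that contains \<open>w\<^sub>0 = 1\<close> and is mapped into itself by multiplication with \<open>g\<close>. In contrast
  to a monic equation this is easily seen to be inherited by sums.
\<close>

definition integral_over_polynomials ::
  "(complex ^ 'n::finite) set \<Rightarrow> (complex ^ 'n \<Rightarrow> complex) \<Rightarrow> bool" where
  "integral_over_polynomials V g \<longleftrightarrow>
     (\<exists>k w A. 0 < (k::nat) \<and> (\<forall>i<k. \<forall>l<k. polynomial_map (A i l)) \<and>
        (\<forall>x\<in>V. w 0 x = 1 \<and> (\<forall>i<k. g x * w i x = (\<Sum>l<k. A i l x * w l x))))"

lemma integral_over_polynomialsI:
  fixes k :: nat
  assumes "0 < k" "\<And>i l. i < k \<Longrightarrow> l < k \<Longrightarrow> polynomial_map (A i l)" "\<And>x. x \<in> V \<Longrightarrow> w 0 x = 1"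
    "\<And>x i. x \<in> V \<Longrightarrow> i < k \<Longrightarrow> g x * w i x = (\<Sum>l<k. A i l x * w l x)"
  shows "integral_over_polynomials V g"
  unfolding integral_over_polynomials_def using assms by (intro exI[of _ k] exI[of _ w] exI[of _ A]) auto

lemma integral_over_polynomials_zero: "integral_over_polynomials V (\<lambda>_. 0)"
  by (rule integral_over_polynomialsI[of 1 "\<lambda>_ _ _. 0" _ "\<lambda>_ _. 1"]) (auto simp: polynomial_map_const)

lemma integral_over_polynomials_cmult:
  assumes "integral_over_polynomials V g"
  shows "integral_over_polynomials V (\<lambda>x. c * g x)"
proof -
  obtain k w A where k: "0 < (k::nat)" "\<forall>i<k. \<forall>l<k. polynomial_map (A i l)"
    "\<forall>x\<in>V. w 0 x = 1 \<and> (\<forall>i<k. g x * w i x = (\<Sum>l<k. A i l x * w l x))"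
    using assms unfolding integral_over_polynomials_def by blast
  show ?thesis
    by (rule integral_over_polynomialsI[of k "\<lambda>i l x. c * A i l x" V w])
      (use k in \<open>auto simp: mult.assoc sum_distrib_left[symmetric] intro!: polynomial_map_mult polynomial_map_const\<close>)
qed

text \<open>
  Pairs \<open>(i, j)\<close> with \<open>j < b\<close> are encoded as \<open>i b + j\<close>, so that modules can be indexed by natural
  numbers.
\<close>

lemma sum_div_mod:
  fixes h :: "nat \<Rightarrow> nat \<Rightarrow> 'a::comm_monoid_add"
  assumes "0 < b"
  shows "(\<Sum>l<a * b. h (l div b) (l mod b)) = (\<Sum>i<a. \<Sum>j<b. h i j)"
proof -
  have "(\<Sum>i<a. \<Sum>j<b. h i j) = (\<Sum>(i, j)\<in>{..<a} \<times> {..<b}. h i j)"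
    by (rule sum.cartesian_product)
  also have "\<dots> = (\<Sum>l<a * b. h (l div b) (l mod b))"
  proof (rule sum.reindex_bij_witness[of _ "\<lambda>l. (l div b, l mod b)" "\<lambda>(i, j). i * b + j"])
    fix p assume "p \<in> {..<a} \<times> {..<b}"
    then obtain i j where p: "p = (i, j)" "i < a" "j < b" by auto
    have "i * b + j < i * b + b" using p by simp
    also have "\<dots> = Suc i * b" by simp
    also have "\<dots> \<le> a * b" using p by (intro mult_right_mono) auto
    finally show "(case p of (i, j) \<Rightarrow> i * b + j) \<in> {..<a * b}" using p by simp
  qed (use assms in \<open>auto simp: less_mult_imp_div_less\<close>)
  finally show ?thesis ..
qed

text \<open>
  The products \<open>u\<^sub>i v\<^sub>j\<close> of the two systems of generators work for the sum: \<open>g\<close> acts on the first factor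
  and \<open>h\<close> on the second.
\<close>

lemma integral_over_polynomials_add:
  assumes "integral_over_polynomials V g" "integral_over_polynomials V h"
  shows "integral_over_polynomials V (\<lambda>x. g x + h x)"
proof -
  obtain a u A where a: "0 < (a::nat)" "\<forall>i<a. \<forall>l<a. polynomial_map (A i l)"
    "\<forall>x\<in>V. u 0 x = 1 \<and> (\<forall>i<a. g x * u i x = (\<Sum>l<a. A i l x * u l x))"
    using assms(1) unfolding integral_over_polynomials_def by blast
  obtain b v B where b: "0 < (b::nat)" "\<forall>i<b. \<forall>l<b. polynomial_map (B i l)"
    "\<forall>x\<in>V. v 0 x = 1 \<and> (\<forall>i<b. h x * v i x = (\<Sum>l<b. B i l x * v l x))"
    using assms(2) unfolding integral_over_polynomials_def by blast
  define C where "C i l x = (if i mod b = l mod b then A (i div b) (l div b) x else 0) +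
      (if i div b = l div b then B (i mod b) (l mod b) x else 0)" for i l x
  have bounds: "i div b < a" "i mod b < b" if "i < a * b" for i
    using that b(1) by (auto simp: less_mult_imp_div_less)
  show ?thesis
  proof (rule integral_over_polynomialsI[of "a * b" C V "\<lambda>i x. u (i div b) x * v (i mod b) x"])
    show "polynomial_map (C i l)" if "i < a * b" "l < a * b" for i l
    proof -
      have "polynomial_map (\<lambda>x. if i mod b = l mod b then A (i div b) (l div b) x else 0)"
        using a(2) bounds(1)[OF that(1)] bounds(1)[OF that(2)]
        by (cases "i mod b = l mod b") (simp_all add: polynomial_map_const)
      moreover have "polynomial_map (\<lambda>x. if i div b = l div b then B (i mod b) (l mod b) x else 0)"
        using b(2) bounds(2)[OF that(1)] bounds(2)[OF that(2)]
        by (cases "i div b = l div b") (simp_all add: polynomial_map_const)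
      ultimately show ?thesis unfolding C_def[abs_def] by (rule polynomial_map_add)
    qed
    show "(g x + h x) * (u (i div b) x * v (i mod b) x) =
        (\<Sum>l<a * b. C i l x * (u (l div b) x * v (l mod b) x))" if x: "x \<in> V" and i: "i < a * b" for x i
    proof -
      let ?i = "i div b" and ?j = "i mod b"
      have "(\<Sum>l<a * b. C i l x * (u (l div b) x * v (l mod b) x)) =
          (\<Sum>p<a. \<Sum>q<b. ((if ?j = q then A ?i p x else 0) + (if ?i = p then B ?j q x else 0)) * (u p x * v q x))"
        unfolding C_def by (rule sum_div_mod[OF b(1)])
      also have "\<dots> = (\<Sum>p<a. \<Sum>q<b. if ?j = q then A ?i p x * u p x * v q x else 0) +
          (\<Sum>p<a. \<Sum>q<b. if ?i = p then B ?j q x * (u p x * v q x) else 0)"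
        unfolding sum.distrib[symmetric] by (intro sum.cong refl) (simp add: distrib_right mult.assoc)
      also have "(\<Sum>p<a. \<Sum>q<b. if ?j = q then A ?i p x * u p x * v q x else 0) = (\<Sum>p<a. A ?i p x * u p x) * v ?j x"
        using bounds(2)[OF i] by (simp add: sum_distrib_right)
      also have "(\<Sum>p<a. A ?i p x * u p x) = g x * u ?i x"
        using a(3) x bounds(1)[OF i] by simp
      also have "(\<Sum>p<a. \<Sum>q<b. if ?i = p then B ?j q x * (u p x * v q x) else 0) = u ?i x * (\<Sum>q<b. B ?j q x * v q x)"
        using bounds(1)[OF i] by (subst sum.swap) (simp add: sum_distrib_left mult_ac)
      also have "(\<Sum>q<b. B ?j q x * v q x) = h x * v ?j x"
        using b(3) x bounds(2)[OF i] by simp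
      finally show ?thesis by (simp add: algebra_simps)
    qed
  qed (use a b in auto)
qed

lemma integral_over_polynomials_sum:
  "(\<And>i. i \<in> I \<Longrightarrow> integral_over_polynomials V (g i)) \<Longrightarrow> integral_over_polynomials V (\<lambda>x. \<Sum>i\<in>I. g i x)"
  by (induction I rule: infinite_finite_induct)
    (simp_all add: integral_over_polynomials_zero integral_over_polynomials_add)

text \<open>
  The generators are \<open>1, y, \<dots>, y\<^bsup>m-1\<^esup>\<close> and the matrix is the companion matrix; \<open>\<mu> j < m\<close> makes the
  equation monic of degree \<open>m\<close>.
\<close>

lemma integral_over_polynomials_root:
  fixes \<mu> :: "'n::finite \<Rightarrow> nat"
  assumes \<mu>: "\<And>j. \<mu> j < m" and p: "\<And>j. polynomial_map (p j)"
    and root: "\<And>x. x \<in> V \<Longrightarrow> y x ^ m + (\<Sum>j\<in>UNIV. p j x * y x ^ \<mu> j) - 1 = 0"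
  shows "integral_over_polynomials V y"
proof -
  have m: "0 < m" using \<mu> less_zeroE by (metis gr0I)
  \<comment> \<open>The rows are \<open>y \<cdot> y\<^sup>i = y\<^bsup>i+1\<^esup>\<close> for \<open>i < m - 1\<close>, and \<open>y\<^sup>m = 1 - \<Sum>\<^sub>j p\<^sub>j y\<^bsup>\<mu>\<^sub>j\<^esup>\<close> last.\<close>
  define A where "A i l = (if Suc i < m then (\<lambda>x. if l = Suc i then 1 else 0)
      else (\<lambda>x. (if l = 0 then 1 else 0) + - (\<Sum>j\<in>UNIV. (if \<mu> j = l then 1 else 0) * p j x)))" for i l
  show ?thesis
  proof (rule integral_over_polynomialsI[of m A V "\<lambda>i x. y x ^ i"])
    show "polynomial_map (A i l)" for i l
      unfolding A_def
      by (cases "Suc i < m")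
        (simp_all only: if_True if_False, intro polynomial_map_const,
         intro polynomial_map_add polynomial_map_uminus polynomial_map_sum polynomial_map_mult polynomial_map_const p)
    show "y x * y x ^ i = (\<Sum>l<m. A i l x * y x ^ l)" if x: "x \<in> V" and i: "i < m" for x i
    proof (cases "Suc i < m")
      case True
      then show ?thesis by (simp add: A_def if_distrib if_distribR cong: if_cong)
    next
      case False
      then have im: "Suc i = m" using i by simp
      have "(\<Sum>l<m. A i l x * y x ^ l) = (\<Sum>l<m. if l = 0 then y x ^ l else 0) -
          (\<Sum>l<m. \<Sum>j\<in>UNIV. if \<mu> j = l then p j x * y x ^ l else 0)"
        unfolding sum_subtractf[symmetric]
      proof (rule sum.cong[OF refl])
        fix l
        have "A i l x = (if l = 0 then 1 else 0) - (\<Sum>j\<in>UNIV. (if \<mu> j = l then 1 else 0) * p j x)"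
          using False by (simp add: A_def)
        moreover have "(\<Sum>j\<in>UNIV. (if \<mu> j = l then 1 else 0) * p j x) * y x ^ l =
            (\<Sum>j\<in>UNIV. if \<mu> j = l then p j x * y x ^ l else 0)"
          unfolding sum_distrib_right by (rule sum.cong) auto
        ultimately show "A i l x * y x ^ l = (if l = 0 then y x ^ l else 0) -
            (\<Sum>j\<in>UNIV. if \<mu> j = l then p j x * y x ^ l else 0)"
          by (simp only: left_diff_distrib) simp
      qed
      also have "(\<Sum>l<m. if l = 0 then y x ^ l else 0) = 1" using m by simp
      also have "(\<Sum>l<m. \<Sum>j\<in>UNIV. if \<mu> j = l then p j x * y x ^ l else 0) = (\<Sum>j\<in>UNIV. p j x * y x ^ \<mu> j)"
        using \<mu> by (subst sum.swap) (simp add: sum.delta')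
      finally have "(\<Sum>l<m. A i l x * y x ^ l) = 1 - (\<Sum>j\<in>UNIV. p j x * y x ^ \<mu> j)" .
      also have "\<dots> = y x ^ m" using root[OF x] by (simp add: algebra_simps)
      also have "\<dots> = y x * y x ^ i" unfolding im[symmetric] by simp
      finally show ?thesis ..
    qed
  qed (use m in auto)
qed

text \<open>
  At each point \<open>x\<close> the generators form an eigenvector with eigenvalue \<open>g(x)\<close>, nonzero thanks to
  \<open>w\<^sub>0 = 1\<close>, so \<open>g(x)\<close> is a root of the characteristic polynomial.
\<close>

theorem integral_imp_monic_equation:
  fixes g :: "complex ^ 'n::finite \<Rightarrow> complex"
  assumes "integral_over_polynomials V g"
  obtains N a where "0 < N" "\<And>k. polynomial_map (a k)" "a N = (\<lambda>_. 1)"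
    "\<And>x. x \<in> V \<Longrightarrow> (\<Sum>k\<le>N. a k x * g x ^ k) = 0"
proof -
  obtain k w A where k: "0 < (k::nat)" "\<forall>i<k. \<forall>l<k. polynomial_map (A i l)"
    "\<forall>x\<in>V. w 0 x = 1 \<and> (\<forall>i<k. g x * w i x = (\<Sum>l<k. A i l x * w l x))"
    using assms unfolding integral_over_polynomials_def by blast
  define M where "M x = mat k k (\<lambda>(i, l). A i l x)" for x
  have M: "M x \<in> carrier_mat k k" for x by (simp add: M_def)
  have deg: "degree (char_poly (M x)) = k" "coeff (char_poly (M x)) k = 1" for x
    using degree_monic_char_poly[OF M] by auto
  show ?thesis
  proof (rule that[of k "\<lambda>t x. coeff (char_poly (M x)) t"])
    show "0 < k" by fact
    show "polynomial_map (\<lambda>x. coeff (char_poly (M x)) t)" for t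
      using polynomial_family_char_poly[of k A] k(2) unfolding polynomial_family_def M_def by blast
    show "(\<lambda>x. coeff (char_poly (M x)) k) = (\<lambda>_. 1)" by (simp add: deg)
    fix x assume x: "x \<in> V"
    define v where "v = Matrix.vec k (\<lambda>i. w i x)"
    have "M x *\<^sub>v v = g x \<cdot>\<^sub>v v"
      by (rule eq_vecI) (use k(3) x in \<open>auto simp: M_def v_def scalar_prod_def atLeast0LessThan\<close>)
    moreover have "v \<noteq> 0\<^sub>v k"
    proof
      assume "v = 0\<^sub>v k"
      then have "vec_index v 0 = vec_index (0\<^sub>v k) 0" by simp
      then show False using k(1,3) x by (simp add: v_def)
    qed
    ultimately have "eigenvector (M x) v (g x)"
      using M[of x] by (simp add: eigenvector_def v_def)
    then have "poly (char_poly (M x)) (g x) = 0"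
      using eigenvalue_root_char_poly[OF M] unfolding eigenvalue_def by blast
    then show "(\<Sum>t\<le>k. coeff (char_poly (M x)) t * g x ^ t) = 0"
      by (simp add: poly_altdef deg)
  qed
qed


section \<open>Algebraicity of the solutions\<close>

lemma polynomial_map_line:
  fixes p :: "complex ^ 'n::finite \<Rightarrow> complex"
  assumes "polynomial_map p"
  shows "(\<lambda>t. p (b + t *s v)) field_differentiable at t0"
proof -
  obtain S c where p: "p = (\<lambda>x. \<Sum>\<nu>\<in>S. c \<nu> * monomial \<nu> x)"
    using assms by (auto simp: polynomial_map_def)
  have "(\<lambda>t. p (b + t *s v)) holomorphic_on UNIV"
    unfolding p monomial_def vector_add_component vector_smult_component
    by (intro holomorphic_intros)
  then show ?thesis by (rule holomorphic_on_imp_differentiable_at) auto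
qed

lemma integral_root_combination:
  fixes \<mu> :: "'n::finite \<Rightarrow> nat"
  assumes \<mu>: "\<And>j. \<mu> j < m"
  shows "integral_over_polynomials (polydisc (root_radius TYPE('n))) (root_combination m \<mu> w)"
  unfolding root_combination_def[abs_def]
proof (intro integral_over_polynomials_sum integral_over_polynomials_cmult)
  fix i :: "'n \<Rightarrow> int"
  have m: "0 < m" using \<mu> by (metis gr0I less_zeroE)
  have \<mu>': "\<mu> j \<le> m" for j using \<mu>[of j] by simp
  show "integral_over_polynomials (polydisc (root_radius TYPE('n))) (\<lambda>x. root_series m \<mu> 1 (rotation m i x))"
  proof (rule integral_over_polynomials_root[OF \<mu>])
    show "polynomial_map (\<lambda>x :: complex ^ 'n. mellin_eps m powi i j * x $ j)" for j
      by (intro polynomial_map_mult polynomial_map_const polynomial_map_coord)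
    fix x :: "complex ^ 'n" assume "x \<in> polydisc (root_radius TYPE('n))"
    then have "rotation m i x \<in> polydisc (root_radius TYPE('n))" by (simp only: rotation_in_polydisc)
    from root_series_equation[of m \<mu>, OF m \<mu>' this]
    show "root_series m \<mu> 1 (rotation m i x) ^ m +
        (\<Sum>j\<in>UNIV. mellin_eps m powi i j * x $ j * root_series m \<mu> 1 (rotation m i x) ^ \<mu> j) - 1 = 0"
      by (simp add: rotation_def)
  qed
qed

text \<open>
  A monic equation holds near the origin by integrality; its left-hand side is holomorphic along
  complex lines, so the identity theorem carries it to all of \<open>U\<close>.
\<close>

lemma mellin_solution_algebraic:
  fixes \<mu> :: "'n::finite \<Rightarrow> nat"
  assumes \<mu>: "\<And>j. \<mu> j < m" and nz: "\<And>\<nu>. root_coeff m \<mu> 1 \<nu> \<noteq> 0"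
    and U: "open U" "connected U" "0 \<in> U" and sol: "mellin_solution_on m \<mu> U f"
  shows "algebraic_function_on U f"
proof -
  have m: "0 < m" using \<mu> by (metis gr0I less_zeroE)
  have \<mu>': "\<mu> j \<le> m" for j using \<mu>[of j] by simp
  obtain w where w: "\<forall>\<^sub>F x in nhds 0. f x = root_combination m \<mu> w x"
    by (rule mellin_solution_imp_root_combination[of m \<mu>, OF m \<mu>' nz U(1,3) sol])
  obtain N a where N: "0 < N" and a: "\<And>k. polynomial_map (a k)" "a N = (\<lambda>_. 1)"
    and eqn: "\<And>x. x \<in> polydisc (root_radius TYPE('n)) \<Longrightarrow> (\<Sum>k\<le>N. a k x * root_combination m \<mu> w x ^ k) = 0"
    by (rule integral_imp_monic_equation[OF integral_root_combination[of \<mu> m w, OF \<mu>]]) blast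
  have an: "mv_analytic_on f U" using sol by (simp add: mellin_solution_on_def)
  have "(\<Sum>k\<le>N. a k x * f x ^ k) = 0" if "x \<in> U" for x
  proof (rule identity_theorem_lines[OF U _ _ that])
    show "(\<lambda>t. \<Sum>k\<le>N. a k (b + t *s v) * f (b + t *s v) ^ k) field_differentiable at t"
      if "b + t *s v \<in> U" for b v t
      by (intro field_differentiable_sum field_differentiable_mult field_differentiable_power
          polynomial_map_line a mv_analytic_on_line[OF an that])
    have "\<forall>\<^sub>F x in nhds 0. x \<in> polydisc (root_radius TYPE('n))"
      by (rule eventually_polydisc[OF root_radius_pos])
    then show "\<forall>\<^sub>F x in nhds 0. (\<Sum>k\<le>N. a k x * f x ^ k) = 0"
      using w by eventually_elim (simp only: eqn)
  qed
  moreover have "a N \<noteq> (\<lambda>x. 0)" unfolding a(2) by (simp add: fun_eq_iff)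
  ultimately show ?thesis
    unfolding algebraic_function_on_def using N a(1) by blast
qed

theorem corollary2p5:
  fixes m :: nat and \<mu> :: "'n::{finite,linorder} \<Rightarrow> nat"
  assumes less_m: "\<And>j. \<mu> j < m"
    and decreasing: "\<And>i j. i < j \<Longrightarrow> \<mu> j < \<mu> i"
    and pos: "\<And>j. 0 < \<mu> j"
    and gcd_gt_1: "Gcd (insert m (range \<mu>)) > 1"
  shows "inj_on (\<lambda>i. germ_of (y_pr_rotated m \<mu> i)) (mellin_B m)
       \<and> germ.independent ((\<lambda>i. germ_of (y_pr_rotated m \<mu> i)) ` mellin_B m)
       \<and> germ.span ((\<lambda>i. germ_of (y_pr_rotated m \<mu> i)) ` mellin_B m) = mellin_solution_space m \<mu>
       \<and> (\<forall>U f. open U \<longrightarrow> connected U \<longrightarrow> 0 \<in> U \<longrightarrow> mellin_solution_on m \<mu> U f \<longrightarrow>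
            algebraic_function_on U f)"
proof -
  have m: "0 < m" using less_m by (metis gr0I less_zeroE)
  have \<mu>: "\<mu> j \<le> m" for j using less_m[of j] by simp
  have nz: "root_coeff m \<mu> 1 \<nu> \<noteq> 0" for \<nu>
    using gcd_gt_1 m by (intro root_coeff_1_nonzero[of "Gcd (insert m (range \<mu>))"] Gcd_dvd) auto
  show ?thesis
    using rotated_germs_basis[of m \<mu>, OF m \<mu> nz] mellin_solution_algebraic[of \<mu> m, OF less_m nz] by blast
qed

end
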